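(* Let $\mathcal E$ be a nonlinear Dirichlet form on $L^2(\mu)$ with $\ker\|\cdot\|_{L_e}=\mathbb R\cdot1$. The following are equivalent: (i) $(M(\mathcal E_e)/\mathbb R\cdot1,\|\cdot\|_{L_e})$ is a Banach space; (ii) the embedding $(M(\mathcal E_e)/\mathbb R\cdot1,\|\cdot\|_{L_e})\to L^0(\mu)/\mathbb R\cdot1$, $f+\mathbb R\cdot1\mapsto f+\mathbb R\cdot1$, is continuous, where $L^0(\mu)/\mathbb R\cdot1$ carries the quotient topology; (iii) for one (equivalently, all) integrable $w\colon X\to(0,\infty)$ and one (equivalently, all) $1\le p<\infty$ there exists a decreasing $\alpha\colon(0,\infty)\to(0,\infty)$ such that for all $r>0$ and all $f\in M(\mathcal E_e)\cap L^\infty(\mu)$: $\left(\int_X|f-\overline f|^pw\,d\mu\right)^{1/p}\le\alpha(r)\|f\|_{L_e}+r\,\delta(f)$, where $\overline f=\frac1{\|w\|_1}\int_Xfw\,d\mu$ and $\delta(f)=\operatorname{ess\,sup}f-\operatorname{ess\,inf}f$.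
   Context: $(X,\mathfrak A,\mu)$ is $\sigma$-finite; $L^0(\mu)$ carries local convergence in measure. A nonlinear Dirichlet form is a lower semicontinuous convex $\mathcal E\colon L^2(\mu)\to[0,\infty]$ with $\mathcal E(-f)=\mathcal E(f)$, $\mathcal E(0)=0$, such that $\mathcal E(f+Cg)+\mathcal E(f-Cg)\le\mathcal E(f+g)+\mathcal E(f-g)$ for all $f,g$ and every 1-Lipschitz $C\colon\mathbb R\to\mathbb R$ with $C(0)=0$. $\mathcal E_e$ is the lower semicontinuous relaxation on $L^0(\mu)$ (w.r.t. local convergence in measure) of $\mathcal E$ extended by $+\infty$ outside $L^2(\mu)$; $M(\mathcal E_e)=\{f:\lim_{\lambda\to0+}\mathcal E_e(\lambda f)=0\}$, $\|f\|_{L_e}=\inf\{\lambda>0:\mathcal E_e(\lambda^{-1}f)\le1\}$. *)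

theory Defs
  imports "HOL-Analysis.Analysis" "HOL-Probability.Essential_Supremum"
begin

section \<open>Function spaces (functions are identified up to mu-a.e. equality implicitly)\<close>

definition L0 :: "'a measure \<Rightarrow> ('a \<Rightarrow> real) set" where
  "L0 M = borel_measurable M"

definition L2 :: "'a measure \<Rightarrow> ('a \<Rightarrow> real) set" where
  "L2 M = {f. f \<in> borel_measurable M \<and> integrable M (\<lambda>x. (f x)\<^sup>2)}"

definition nonlinear_dirichlet_form :: "'a measure \<Rightarrow> (('a \<Rightarrow> real) \<Rightarrow> ennreal) \<Rightarrow> bool" where
  "nonlinear_dirichlet_form M E \<longleftrightarrow>
     \<comment> \<open>E is a function on L2 = equivalence classes\<close>
     (\<forall>f\<in>L2 M. \<forall>g\<in>L2 M. (AE x in M. f x = g x) \<longrightarrow> E f = E g) \<and>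
     \<comment> \<open>lower semicontinuous w.r.t. the L2 norm\<close>
     (\<forall>F f. (\<forall>n. F n \<in> L2 M) \<and> f \<in> L2 M \<and>
            ((\<lambda>n. integral\<^sup>L M (\<lambda>x. (F n x - f x)\<^sup>2)) \<longlonglongrightarrow> 0)
            \<longrightarrow> E f \<le> liminf (\<lambda>n. E (F n))) \<and>
     \<comment> \<open>convex\<close>
     (\<forall>f\<in>L2 M. \<forall>g\<in>L2 M. \<forall>t::real. 0 \<le> t \<and> t \<le> 1 \<longrightarrow>
        E (\<lambda>x. t * f x + (1 - t) * g x) \<le> ennreal t * E f + ennreal (1 - t) * E g) \<and>
     \<comment> \<open>symmetric and normalised\<close>
     (\<forall>f\<in>L2 M. E (\<lambda>x. - f x) = E f) \<and>
     E (\<lambda>x. 0) = 0 \<and>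
     \<comment> \<open>contraction property\<close>
     (\<forall>f\<in>L2 M. \<forall>g\<in>L2 M. \<forall>C::real \<Rightarrow> real.
        (\<forall>s t. \<bar>C s - C t\<bar> \<le> \<bar>s - t\<bar>) \<and> C 0 = 0 \<longrightarrow>
        E (\<lambda>x. f x + C (g x)) + E (\<lambda>x. f x - C (g x))
          \<le> E (\<lambda>x. f x + g x) + E (\<lambda>x. f x - g x))"

definition E_ext :: "'a measure \<Rightarrow> (('a \<Rightarrow> real) \<Rightarrow> ennreal) \<Rightarrow> ('a \<Rightarrow> real) \<Rightarrow> ennreal" where
  "E_ext M E f = (if f \<in> L2 M then E f else \<infinity>)"

definition lcm_nbhd :: "'a measure \<Rightarrow> ('a \<Rightarrow> real) \<Rightarrow> 'a set \<Rightarrow> real \<Rightarrow> ('a \<Rightarrow> real) set" where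
  "lcm_nbhd M f A e =
     {g \<in> L0 M. emeasure M (A \<inter> {x \<in> space M. \<bar>g x - f x\<bar> > e}) < ennreal e}"

definition lcm_topology :: "'a measure \<Rightarrow> ('a \<Rightarrow> real) topology" where
  "lcm_topology M = topology (\<lambda>S. S \<subseteq> L0 M \<and>
     (\<forall>f\<in>S. \<exists>A e. A \<in> sets M \<and> emeasure M A < \<infinity> \<and> e > 0 \<and> lcm_nbhd M f A e \<subseteq> S))"

text \<open>Lower semicontinuous relaxation (lsc envelope) of E_ext w.r.t. local convergence in measure.\<close>
definition E_e :: "'a measure \<Rightarrow> (('a \<Rightarrow> real) \<Rightarrow> ennreal) \<Rightarrow> ('a \<Rightarrow> real) \<Rightarrow> ennreal" where
  "E_e M E f = (SUP U \<in> {U. openin (lcm_topology M) U \<and> f \<in> U}. INF g \<in> U. E_ext M E g)"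

definition dom_M :: "'a measure \<Rightarrow> (('a \<Rightarrow> real) \<Rightarrow> ennreal) \<Rightarrow> ('a \<Rightarrow> real) set" where
  "dom_M M E = {f \<in> L0 M. ((\<lambda>t. E_e M E (\<lambda>x. t * f x)) \<longlongrightarrow> 0) (at_right (0::real))}"

definition Le_norm :: "'a measure \<Rightarrow> (('a \<Rightarrow> real) \<Rightarrow> ennreal) \<Rightarrow> ('a \<Rightarrow> real) \<Rightarrow> real" where
  "Le_norm M E f = Inf {l::real. l > 0 \<and> E_e M E (\<lambda>x. f x / l) \<le> 1}"

definition cls :: "'a measure \<Rightarrow> ('a \<Rightarrow> real) \<Rightarrow> ('a \<Rightarrow> real) set" where
  "cls M f = {g \<in> L0 M. \<exists>c::real. AE x in M. g x = f x + c}"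

definition L0_quot_topology :: "'a measure \<Rightarrow> ('a \<Rightarrow> real) set topology" where
  "L0_quot_topology M = topology (\<lambda>U. U \<subseteq> cls M ` L0 M \<and>
     openin (lcm_topology M) {f \<in> L0 M. cls M f \<in> U})"

definition Me_quot_topology :: "'a measure \<Rightarrow> (('a \<Rightarrow> real) \<Rightarrow> ennreal) \<Rightarrow> ('a \<Rightarrow> real) set topology" where
  "Me_quot_topology M E = topology (\<lambda>U. U \<subseteq> cls M ` dom_M M E \<and>
     (\<forall>f\<in>dom_M M E. cls M f \<in> U \<longrightarrow>
        (\<exists>r>0. \<forall>g\<in>dom_M M E. Le_norm M E (\<lambda>x. g x - f x) < r \<longrightarrow> cls M g \<in> U)))"

text \<open>Completeness of the (semi)normed space (M(E_e), norm), i.e. of its quotient by R1.\<close>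
definition Me_complete :: "'a measure \<Rightarrow> (('a \<Rightarrow> real) \<Rightarrow> ennreal) \<Rightarrow> bool" where
  "Me_complete M E \<longleftrightarrow>
     (\<forall>F. (\<forall>n. F n \<in> dom_M M E) \<and>
          (\<forall>e>0. \<exists>N. \<forall>m\<ge>N. \<forall>n\<ge>N. Le_norm M E (\<lambda>x. F m x - F n x) < e)
      \<longrightarrow> (\<exists>f\<in>dom_M M E. (\<lambda>n. Le_norm M E (\<lambda>x. F n x - f x)) \<longlonglongrightarrow> 0))"

definition Linf :: "'a measure \<Rightarrow> ('a \<Rightarrow> real) set" where
  "Linf M = {f \<in> borel_measurable M. \<exists>C. AE x in M. \<bar>f x\<bar> \<le> C}"

definition osc :: "'a measure \<Rightarrow> ('a \<Rightarrow> real) \<Rightarrow> real" where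
  "osc M f = real_of_ereal (esssup M (\<lambda>x. ereal (f x)) - (- esssup M (\<lambda>x. ereal (- f x))))"

definition weight :: "'a measure \<Rightarrow> ('a \<Rightarrow> real) \<Rightarrow> bool" where
  "weight M w \<longleftrightarrow> w \<in> borel_measurable M \<and> integrable M w \<and> (\<forall>x\<in>space M. w x > 0)"

definition wmean :: "'a measure \<Rightarrow> ('a \<Rightarrow> real) \<Rightarrow> ('a \<Rightarrow> real) \<Rightarrow> real" where
  "wmean M w f = (integral\<^sup>L M (\<lambda>x. f x * w x)) / (integral\<^sup>L M w)"

definition cond_iii :: "'a measure \<Rightarrow> (('a \<Rightarrow> real) \<Rightarrow> ennreal) \<Rightarrow> ('a \<Rightarrow> real) \<Rightarrow> real \<Rightarrow> bool" where
  "cond_iii M E w p \<longleftrightarrow>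
     (\<exists>\<alpha>::real \<Rightarrow> real. (\<forall>r>0. \<alpha> r > 0) \<and> (\<forall>r s. 0 < r \<and> r \<le> s \<longrightarrow> \<alpha> s \<le> \<alpha> r) \<and>
       (\<forall>r>0. \<forall>f \<in> dom_M M E \<inter> Linf M.
          (integral\<^sup>L M (\<lambda>x. \<bar>f x - wmean M w f\<bar> powr p * w x)) powr (1 / p)
            \<le> \<alpha> r * Le_norm M E f + r * osc M f))"

end

theory Submission
  imports Defs
begin

text \<open>
  Fix an integrable weight \<open>w > 0\<close>. Local convergence in measure is metrised by the F-norm
  \<open>\<rho>(f) = \<integral> min(|f|, 1) w d\<mu>\<close>, which is complete, and both (ii) and each instance of (iii) amount to the
  single estimate: for every \<open>\<epsilon>\<close> there is \<open>\<eta>\<close> such that \<open>\<parallel>f\<parallel> < \<eta>\<close> implies \<open>\<rho>(f - c) < \<epsilon>\<close> for some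
  constant \<open>c\<close>.

  Given this estimate, a Cauchy sequence for the Luxemburg seminorm converges locally in measure after
  subtracting constants along a subsequence, and lower semicontinuity of the relaxed form makes the
  limit a limit in seminorm. Conversely, lower semicontinuity and the assumption on the kernel show that the
  embedding has closed graph, so completeness yields the estimate by the closed graph argument
  (a Baire category step followed by successive approximation).

  For (iii), normalise \<open>\<delta>(f) = 1\<close>: either \<open>\<parallel>f\<parallel>\<close> is not small and the left-hand side is absorbed in
  \<open>\<alpha>(r) \<parallel>f\<parallel>\<close>, or \<open>f\<close> is \<open>\<rho>\<close>-close to a constant and hence to its mean. Conversely, the intermediate value
  theorem provides \<open>c\<close> for which the truncation of \<open>f - c\<close> to \<open>[-1, 1]\<close> has mean zero; truncation does not
  increase the seminorm, so (iii) applied to it bounds \<open>\<rho>(f - c)\<close>.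
\<close>

section \<open>Local convergence in measure as a metric topology\<close>

locale weighted_measure =
  fixes M :: "'a measure" and w :: "'a \<Rightarrow> real"
  assumes weight: "weight M w"
begin

lemma w_measurable [measurable]: "w \<in> borel_measurable M"
  and w_integrable: "integrable M w"
  and w_pos: "x \<in> space M \<Longrightarrow> w x > 0"
  using weight by (auto simp: weight_def)

lemma w_nonneg: "x \<in> space M \<Longrightarrow> w x \<ge> 0"
  using w_pos[of x] by simp

text \<open>The cut-off at 1 makes the integral finite for every measurable \<open>f\<close>. The
  price is that \<open>rho\<close> is subadditive but not homogeneous.\<close>

definition rho :: "('a \<Rightarrow> real) \<Rightarrow> real" where
  "rho f = (LINT x|M. min \<bar>f x\<bar> 1 * w x)"

lemma rho_integrable:
  assumes "f \<in> L0 M"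
  shows "integrable M (\<lambda>x. min \<bar>f x\<bar> 1 * w x)"
proof (rule Bochner_Integration.integrable_bound[OF w_integrable])
  show "(\<lambda>x. min \<bar>f x\<bar> 1 * w x) \<in> borel_measurable M"
    using assms by (simp add: L0_def)
  show "AE x in M. norm (min \<bar>f x\<bar> 1 * w x) \<le> norm (w x)"
    by (auto intro!: AE_I2 mult_left_le_one_le simp: abs_mult)
qed

lemma rho_nonneg: "rho f \<ge> 0"
  unfolding rho_def using w_nonneg by (intro integral_nonneg_AE AE_I2) auto

lemma rho_mono:
  assumes "f \<in> L0 M" "g \<in> L0 M" "AE x in M. \<bar>f x\<bar> \<le> \<bar>g x\<bar>"
  shows "rho f \<le> rho g"
  unfolding rho_def
proof (rule integral_mono_AE[OF rho_integrable[OF assms(1)] rho_integrable[OF assms(2)]])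
  show "AE x in M. min \<bar>f x\<bar> 1 * w x \<le> min \<bar>g x\<bar> 1 * w x"
    using assms(3) AE_space
  proof eventually_elim
    case (elim x)
    then show ?case using w_nonneg[of x] by (intro mult_right_mono) auto
  qed
qed

lemma rho_cong:
  assumes "f \<in> L0 M" "g \<in> L0 M" "AE x in M. \<bar>f x\<bar> = \<bar>g x\<bar>"
  shows "rho f = rho g"
proof (rule antisym)
  show "rho f \<le> rho g"
    by (rule rho_mono[OF assms(1,2)]) (use assms(3) in eventually_elim, simp)
  show "rho g \<le> rho f"
    by (rule rho_mono[OF assms(2,1)]) (use assms(3) in eventually_elim, simp)
qed

lemma rho_zero [simp]: "rho (\<lambda>x. 0) = 0"
  by (simp add: rho_def)

lemma rho_minus [simp]: "rho (\<lambda>x. - f x) = rho f"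
  by (simp add: rho_def)

lemma rho_minus_commute: "rho (\<lambda>x. f x - g x) = rho (\<lambda>x. g x - f x)"
  by (simp add: rho_def abs_minus_commute)

lemma rho_add_le:
  assumes "f \<in> L0 M" "g \<in> L0 M"
  shows "rho (\<lambda>x. f x + g x) \<le> rho f + rho g"
proof -
  have fg: "(\<lambda>x. f x + g x) \<in> L0 M" using assms by (simp add: L0_def)
  have "rho (\<lambda>x. f x + g x) \<le> (LINT x|M. min \<bar>f x\<bar> 1 * w x + min \<bar>g x\<bar> 1 * w x)"
    unfolding rho_def
  proof (rule integral_mono[OF rho_integrable[OF fg]])
    fix x assume "x \<in> space M"
    have "min \<bar>f x + g x\<bar> 1 \<le> min \<bar>f x\<bar> 1 + min \<bar>g x\<bar> 1" by linarith
    from mult_right_mono[OF this w_nonneg[OF \<open>x \<in> space M\<close>]]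
    show "min \<bar>f x + g x\<bar> 1 * w x \<le> min \<bar>f x\<bar> 1 * w x + min \<bar>g x\<bar> 1 * w x"
      by (simp add: distrib_right)
  qed (intro Bochner_Integration.integrable_add rho_integrable assms)
  also have "\<dots> = rho f + rho g"
    unfolding rho_def by (intro Bochner_Integration.integral_add rho_integrable assms)
  finally show ?thesis .
qed

lemma rho_triangle:
  assumes "f \<in> L0 M" "g \<in> L0 M" "h \<in> L0 M"
  shows "rho (\<lambda>x. f x - h x) \<le> rho (\<lambda>x. f x - g x) + rho (\<lambda>x. g x - h x)"
  using rho_add_le[of "\<lambda>x. f x - g x" "\<lambda>x. g x - h x"] assms by (simp add: L0_def)

lemma rho_cmult_le:
  assumes "f \<in> L0 M"
  shows "rho (\<lambda>x. c * f x) \<le> max 1 \<bar>c\<bar> * rho f"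
proof -
  have cf: "(\<lambda>x. c * f x) \<in> L0 M" using assms by (simp add: L0_def)
  have "rho (\<lambda>x. c * f x) \<le> (LINT x|M. max 1 \<bar>c\<bar> * (min \<bar>f x\<bar> 1 * w x))"
    unfolding rho_def
  proof (rule integral_mono[OF rho_integrable[OF cf]])
    fix x assume x: "x \<in> space M"
    have "\<bar>c * f x\<bar> \<le> max 1 \<bar>c\<bar> * \<bar>f x\<bar>"
      unfolding abs_mult by (intro mult_right_mono) auto
    then have "min \<bar>c * f x\<bar> 1 \<le> max 1 \<bar>c\<bar> * min \<bar>f x\<bar> 1"
      by (auto simp: min_def)
    from mult_right_mono[OF this w_nonneg[OF x]]
    show "min \<bar>c * f x\<bar> 1 * w x \<le> max 1 \<bar>c\<bar> * (min \<bar>f x\<bar> 1 * w x)"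
      by (simp add: mult.assoc)
  qed (intro integrable_mult_right rho_integrable assms)
  also have "\<dots> = max 1 \<bar>c\<bar> * rho f"
    by (simp add: rho_def)
  finally show ?thesis .
qed

lemma rho_scale_le:
  assumes "f \<in> L0 M" "\<bar>c\<bar> \<le> 1"
  shows "rho (\<lambda>x. c * f x) \<le> rho f"
  using rho_cmult_le[OF assms(1), of c] assms(2) by simp

lemma rho_tendsto_0:
  assumes "\<And>n. f n \<in> L0 M" "AE x in M. (\<lambda>n. f n x) \<longlonglongrightarrow> 0"
  shows "(\<lambda>n. rho (f n)) \<longlonglongrightarrow> 0"
proof -
  have "(\<lambda>n. LINT x|M. min \<bar>f n x\<bar> 1 * w x) \<longlonglongrightarrow> (LINT x|M. 0)"
  proof (rule integral_dominated_convergence[where w = w])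
    show "AE x in M. (\<lambda>n. min \<bar>f n x\<bar> 1 * w x) \<longlonglongrightarrow> 0"
      using assms(2)
    proof eventually_elim
      case (elim x)
      have "(\<lambda>n. min \<bar>f n x\<bar> 1 * w x) \<longlonglongrightarrow> min \<bar>0\<bar> 1 * w x"
        by (intro tendsto_intros elim)
      then show ?case by simp
    qed
    show "\<And>i. AE x in M. norm (min \<bar>f i x\<bar> 1 * w x) \<le> w x"
      using w_nonneg by (auto intro!: AE_I2 mult_left_le_one_le simp: abs_mult)
    show "\<And>i. (\<lambda>x. min \<bar>f i x\<bar> 1 * w x) \<in> borel_measurable M"
      using assms(1) by (auto simp: L0_def)
  qed (use w_integrable in auto)
  then show ?thesis by (simp add: rho_def)
qed

text \<open>Summable increments give convergence almost everywhere: sum and integral commute, and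
  dividing by \<open>w x > 0\<close> leaves a summable series of cut-off increments. Dominated
  convergence then turns the pointwise limit into a \<open>rho\<close>-limit.\<close>

lemma rho_complete:
  assumes G: "\<And>n. G n \<in> L0 M"
    and summ: "summable (\<lambda>n. rho (\<lambda>x. G (Suc n) x - G n x))"
  obtains h where "h \<in> L0 M" "(\<lambda>n. rho (\<lambda>x. G n x - h x)) \<longlonglongrightarrow> 0"
proof
  have [measurable]: "\<And>n. G n \<in> borel_measurable M" using G by (simp add: L0_def)
  define D where "D n x = G (Suc n) x - G n x" for n x
  have D: "D n \<in> L0 M" for n by (simp add: L0_def D_def[abs_def])
  then have [measurable]: "\<And>n. D n \<in> borel_measurable M" by (simp add: L0_def)
  define u where "u n x = min \<bar>D n x\<bar> 1 * w x" for n x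
  have u_nonneg: "x \<in> space M \<Longrightarrow> u n x \<ge> 0" for n x
    using w_nonneg by (simp add: u_def)
  have nn: "(\<integral>\<^sup>+x. ennreal (u n x) \<partial>M) = ennreal (rho (D n))" for n
    using rho_integrable[OF D] u_nonneg
    by (subst nn_integral_eq_integral) (auto simp: u_def[abs_def] rho_def)
  have "(\<integral>\<^sup>+x. (\<Sum>n. ennreal (u n x)) \<partial>M) = (\<Sum>n. ennreal (rho (D n)))"
    by (subst nn_integral_suminf) (simp_all add: nn, simp add: u_def[abs_def])
  also have "\<dots> = ennreal (\<Sum>n. rho (D n))"
    using summ by (intro suminf_ennreal2) (auto simp: rho_nonneg D_def[abs_def])
  finally have "(\<integral>\<^sup>+x. (\<Sum>n. ennreal (u n x)) \<partial>M) \<noteq> \<infinity>" by simp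
  then have "AE x in M. (\<Sum>n. ennreal (u n x)) \<noteq> \<infinity>"
    by (intro nn_integral_PInf_AE) (auto simp: u_def[abs_def])
  then have conv: "AE x in M. convergent (\<lambda>n. G n x)"
    using AE_space
  proof eventually_elim
    case (elim x)
    have "summable (\<lambda>n. u n x)"
      using elim u_nonneg by (intro summable_suminf_not_top) auto
    from summable_mult2[OF this, of "1 / w x"] have s: "summable (\<lambda>n. min \<bar>D n x\<bar> 1)"
      using w_pos[OF elim(2)] by (simp add: u_def)
    then have "(\<lambda>n. min \<bar>D n x\<bar> 1) \<longlonglongrightarrow> 0" by (rule summable_LIMSEQ_zero)
    \<comment> \<open>The terms of a summable series are eventually below 1, so the cut-off becomes
      inactive and the increments themselves are summable.\<close>
    then have "eventually (\<lambda>n. min \<bar>D n x\<bar> 1 < 1) sequentially"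
      by (rule order_tendstoD) simp
    then have "eventually (\<lambda>n. norm (D n x) \<le> min \<bar>D n x\<bar> 1) sequentially"
      by eventually_elim auto
    from summable_comparison_test_ev[OF this s]
    have "summable (\<lambda>n. D n x)" .
    then have "convergent (\<lambda>n. (\<Sum>k<n. D k x) + G 0 x)"
      by (intro convergent_add convergent_const) (simp add: summable_iff_convergent)
    then show ?case by (simp add: D_def sum_lessThan_telescope[of "\<lambda>n. G n x"])
  qed
  define h where "h x = lim (\<lambda>n. G n x)" for x
  show h: "h \<in> L0 M" by (simp add: h_def[abs_def] L0_def)
  show "(\<lambda>n. rho (\<lambda>x. G n x - h x)) \<longlonglongrightarrow> 0"
  proof (rule rho_tendsto_0)
    show "(\<lambda>x. G n x - h x) \<in> L0 M" for n using G h by (simp add: L0_def)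
    show "AE x in M. (\<lambda>n. G n x - h x) \<longlonglongrightarrow> 0"
      using conv by eventually_elim (auto intro!: LIM_zero simp: h_def convergent_LIMSEQ_iff)
  qed
qed

section \<open>Equivalence of local convergence in measure and
  \<open>rho\<close>-convergence\<close>

text \<open>The weight may come close to 0 on \<open>A\<close>, but the sets \<open>B n\<close>
  where it is at most \<open>1/(n+1)\<close> decrease to the empty set; as \<open>A\<close> has
  finite measure, some \<open>B n\<close> has measure below \<open>e/2\<close>. Off
  \<open>B n\<close> Markov's inequality applies.\<close>

lemma lcm_nbhd_contains_rho_ball:
  assumes A [measurable]: "A \<in> sets M" and fin: "emeasure M A < \<infinity>" and e: "e > 0" and f: "f \<in> L0 M"
  obtains \<eta> where "\<eta> > 0" "\<And>g. g \<in> L0 M \<Longrightarrow> rho (\<lambda>x. g x - f x) < \<eta> \<Longrightarrow> g \<in> lcm_nbhd M f A e"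
proof -
  have [measurable]: "f \<in> borel_measurable M" using f by (simp add: L0_def)
  define B where "B n = A \<inter> {x \<in> space M. w x \<le> 1 / real (Suc n)}" for n
  have Bs [measurable]: "B n \<in> sets M" for n unfolding B_def by measurable
  have Binf: "(\<Inter>n. B n) = {}"
  proof -
    have False if "x \<in> (\<Inter>n. B n)" for x
    proof -
      have "x \<in> space M" using that by (auto simp: B_def)
      from reals_Archimedean[OF w_pos[OF this]] obtain n where "inverse (real (Suc n)) < w x" by blast
      moreover have "w x \<le> 1 / real (Suc n)" using that by (auto simp: B_def)
      ultimately show False by (simp add: inverse_eq_divide)
    qed
    then show ?thesis by blast
  qed
  have "(\<lambda>n. emeasure M (B n)) \<longlonglongrightarrow> emeasure M (\<Inter>n. B n)"
  proof (rule Lim_emeasure_decseq)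
    show "decseq B"
      unfolding decseq_def B_def
    proof safe
      fix m n :: nat and x assume "m \<le> n" "w x \<le> 1 / real (Suc n)"
      then show "w x \<le> 1 / real (Suc m)"
        by (meson divide_left_mono dual_order.trans mult_pos_pos of_nat_0_less_iff of_nat_le_iff Suc_le_mono zero_le_one zero_less_Suc)
    qed
    show "emeasure M (B n) \<noteq> \<infinity>" for n
      using emeasure_mono[of "B n" A M] fin by (auto simp: B_def)
  qed auto
  then have "(\<lambda>n. emeasure M (B n)) \<longlonglongrightarrow> 0" by (simp add: Binf)
  then have "eventually (\<lambda>n. emeasure M (B n) < ennreal (e/2)) sequentially"
    by (rule order_tendstoD) (use e in simp)
  then obtain n where n: "emeasure M (B n) < ennreal (e/2)"
    by (auto simp: eventually_sequentially)
  \<comment> \<open>A point of \<open>A\<close> outside \<open>B n\<close> with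
    \<open>|g - f| > e\<close> has integrand at least \<open>k\<close>, so Markov's inequality turns
    \<open>rho < k * e / 2\<close> into measure below \<open>e/2\<close>.\<close>
  define k where "k = min e 1 / real (Suc n)"
  have k: "k > 0" using e by (simp add: k_def)
  show thesis
  proof
    show "k * e / 2 > 0" using k e by simp
    fix g assume g: "g \<in> L0 M" and r: "rho (\<lambda>x. g x - f x) < k * e / 2"
    have [measurable]: "g \<in> borel_measurable M" using g by (simp add: L0_def)
    have gf: "(\<lambda>x. g x - f x) \<in> L0 M" by (simp add: L0_def)
    let ?T = "{x \<in> space M. k \<le> min \<bar>g x - f x\<bar> 1 * w x}"
    have "A \<inter> {x \<in> space M. \<bar>g x - f x\<bar> > e} \<subseteq> B n \<union> ?T"
    proof
      fix x assume x: "x \<in> A \<inter> {x \<in> space M. \<bar>g x - f x\<bar> > e}"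
      show "x \<in> B n \<union> ?T"
      proof (cases "w x \<le> 1 / real (Suc n)")
        case False
        then have "min e 1 * (1 / real (Suc n)) \<le> min \<bar>g x - f x\<bar> 1 * w x"
          using x e by (intro mult_mono) auto
        then show ?thesis using x by (simp add: k_def)
      qed (use x in \<open>auto simp: B_def\<close>)
    qed
    then have "emeasure M (A \<inter> {x \<in> space M. \<bar>g x - f x\<bar> > e}) \<le> emeasure M (B n) + emeasure M ?T"
      by (intro order_trans[OF emeasure_mono emeasure_subadditive]) auto
    also have "\<dots> < ennreal (e/2) + ennreal (e/2)"
    proof (rule add_strict_mono[OF n])
      have "emeasure M ?T \<le> ennreal (1/k * rho (\<lambda>x. g x - f x))"
        unfolding rho_def using k w_nonneg
        by (intro integral_Markov_inequality rho_integrable gf AE_I2) auto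
      also have "\<dots> < ennreal (e/2)"
        using r k e by (intro ennreal_lessI) (auto simp: field_simps)
      finally show "emeasure M ?T < ennreal (e/2)" .
    qed
    also have "\<dots> = ennreal e" using e by (simp flip: ennreal_plus)
    finally show "g \<in> lcm_nbhd M f A e" using g by (simp add: lcm_nbhd_def)
  qed
qed

text \<open>Up to a part of small integral, the weight is bounded and lives on a set
  \<open>A\<close> of finite measure. There a small deviation, or any deviation on a set of small
  measure, contributes little. \<open>A\<close> and \<open>e\<close> depend on \<epsilon>
  alone.\<close>

lemma rho_ball_contains_lcm_nbhd:
  assumes "\<epsilon> > 0"
  obtains A e where "A \<in> sets M" "emeasure M A < \<infinity>" "e > 0"
    "\<And>f g. f \<in> L0 M \<Longrightarrow> g \<in> lcm_nbhd M f A e \<Longrightarrow> rho (\<lambda>x. g x - f x) < \<epsilon>"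
proof -
  \<comment> \<open>The part of the weight with values at most \<open>1/(n+1)\<close> or above
    \<open>n\<close>; its integral tends to 0 by dominated convergence.\<close>
  define u where "u n x = (if w x \<le> 1 / real (Suc n) \<or> w x > real n then w x else 0)" for n x
  have um [measurable]: "u n \<in> borel_measurable M" for n
    unfolding u_def[abs_def] by measurable
  have ub: "x \<in> space M \<Longrightarrow> norm (u n x) \<le> w x" for n x
    using w_nonneg[of x] by (auto simp: u_def)
  have ui: "integrable M (u n)" for n
    using ub w_nonneg by (intro Bochner_Integration.integrable_bound[OF w_integrable um]) (auto intro!: AE_I2)
  have "(\<lambda>n. LINT x|M. u n x) \<longlonglongrightarrow> (LINT x|M. 0)"
  proof (rule integral_dominated_convergence[where w = w])
    show "AE x in M. (\<lambda>n. u n x) \<longlonglongrightarrow> 0"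
    proof (rule AE_I2)
      fix x assume x: "x \<in> space M"
      have "eventually (\<lambda>n. 1 / real (Suc n) < w x) sequentially"
        using order_tendstoD(2)[OF LIMSEQ_inverse_real_of_nat w_pos[OF x]] by (simp add: inverse_eq_divide)
      moreover have "eventually (\<lambda>n. w x \<le> real n) sequentially"
        using filterlim_real_sequentially by (auto simp: filterlim_at_top)
      ultimately have "eventually (\<lambda>n. u n x = 0) sequentially"
        by eventually_elim (auto simp: u_def)
      then show "(\<lambda>n. u n x) \<longlonglongrightarrow> 0" by (rule tendsto_eventually)
    qed
  qed (use w_integrable ub in \<open>auto intro!: AE_I2\<close>)
  then have "eventually (\<lambda>n. (LINT x|M. u n x) < \<epsilon>/2) sequentially"
    using order_tendstoD(2)[of _ 0 sequentially "\<epsilon>/2"] assms by simp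
  then obtain n where n: "(LINT x|M. u n x) < \<epsilon>/2"
    by (auto simp: eventually_sequentially)
  define W where "W = (LINT x|M. w x)"
  have W: "W \<ge> 0" unfolding W_def by (intro integral_nonneg_AE AE_I2 w_nonneg)
  define A where "A = {x \<in> space M. 1 / real (Suc n) \<le> w x}"
  \<comment> \<open>Points with deviation at most \<open>e\<close> contribute at most
    \<open>e * W\<close>, the exceptional set at most \<open>n * e\<close>; the extra 1 makes the
    total strictly less than \<open>\<epsilon>/2\<close>.\<close>
  define e where "e = \<epsilon> / (2 * (W + real n + 1))"
  have As [measurable]: "A \<in> sets M" unfolding A_def by measurable
  have e: "e > 0" using W assms by (simp add: e_def)
  have "emeasure M A \<le> ennreal (1 / (1 / real (Suc n)) * (LINT x|M. w x))"
    unfolding A_def by (intro integral_Markov_inequality w_integrable AE_I2 w_nonneg) auto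
  then have Af: "emeasure M A < \<infinity>" by (simp add: order_le_less_trans)
  show thesis
  proof (rule that[OF As Af e])
    fix f g assume f: "f \<in> L0 M" and g: "g \<in> lcm_nbhd M f A e"
    then have [measurable]: "f \<in> borel_measurable M" "g \<in> borel_measurable M"
      by (auto simp: lcm_nbhd_def L0_def)
    have gf: "(\<lambda>x. g x - f x) \<in> L0 M" by (simp add: L0_def)
    let ?T = "A \<inter> {x \<in> space M. \<bar>g x - f x\<bar> > e}"
    have Tm: "emeasure M ?T < ennreal e" using g by (simp add: lcm_nbhd_def)
    have Ts [measurable]: "?T \<in> sets M" by measurable
    have Ti: "integrable M (indicat_real ?T)"
      using Tm by (intro integrable_real_indicator Ts) (auto simp: order_less_trans)
    have mT: "measure M ?T \<le> e"
      unfolding measure_def using Tm e by (intro enn2real_leI) auto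
    have "rho (\<lambda>x. g x - f x) \<le> (LINT x|M. u n x + e * w x + real n * indicat_real ?T x)"
      unfolding rho_def
    proof (rule integral_mono[OF rho_integrable[OF gf]])
      fix x assume x: "x \<in> space M"
      have wx: "w x \<ge> 0" using w_nonneg[OF x] .
      have ew: "e * w x \<ge> 0" using e wx by simp
      have le: "min \<bar>g x - f x\<bar> 1 * w x \<le> w x" using wx by (intro mult_left_le_one_le) auto
      show "min \<bar>g x - f x\<bar> 1 * w x \<le> u n x + e * w x + real n * indicat_real ?T x"
      proof (cases "w x \<le> 1 / real (Suc n) \<or> w x > real n")
        case True
        then show ?thesis using le ew by (simp add: u_def indicator_def)
      next
        case False
        then have xA: "x \<in> A" and wn: "w x \<le> real n" and u0: "u n x = 0"
          using x by (auto simp: A_def u_def)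
        show ?thesis
        proof (cases "\<bar>g x - f x\<bar> > e")
          case True
          then have "indicat_real ?T x = 1" using xA x by (simp add: indicator_def)
          then show ?thesis using le wn u0 ew by simp
        next
          case False
          then have "min \<bar>g x - f x\<bar> 1 * w x \<le> e * w x" using wx by (intro mult_right_mono) auto
          then show ?thesis using u0 by (simp add: indicator_def)
        qed
      qed
    qed (intro Bochner_Integration.integrable_add integrable_mult_right ui w_integrable Ti)
    also have "\<dots> = (LINT x|M. u n x) + e * W + real n * measure M ?T"
      using ui w_integrable Ti by (simp add: W_def)
    also have "\<dots> \<le> (LINT x|M. u n x) + e * W + real n * e"
      using mT by (intro add_left_mono mult_left_mono) auto
    also have "\<dots> < \<epsilon> / 2 + e * (W + real n + 1)"
      using n e by (simp add: algebra_simps)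
    also have "e * (W + real n + 1) = \<epsilon> / 2"
      using W by (simp add: e_def field_simps)
    finally show "rho (\<lambda>x. g x - f x) < \<epsilon>" by simp
  qed
qed

text \<open>The two comparison lemmas identify the predicate behind \<open>lcm_topology\<close> with
  the one for \<open>rho\<close>-balls. The topology axioms, needed to recover the open sets from
  \<open>topology\<close>, are checked for balls, where an intersection only needs the smaller
  radius.\<close>

lemma openin_lcm_iff:
  "openin (lcm_topology M) S \<longleftrightarrow>
     S \<subseteq> L0 M \<and> (\<forall>f\<in>S. \<exists>\<epsilon>>0. \<forall>g\<in>L0 M. rho (\<lambda>x. g x - f x) < \<epsilon> \<longrightarrow> g \<in> S)"
proof -
  define P where "P S \<longleftrightarrow> S \<subseteq> L0 M \<and>
    (\<forall>f\<in>S. \<exists>\<epsilon>>0. \<forall>g\<in>L0 M. rho (\<lambda>x. g x - f x) < \<epsilon> \<longrightarrow> g \<in> S)" for S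
  have eq: "(S \<subseteq> L0 M \<and> (\<forall>f\<in>S. \<exists>A e. A \<in> sets M \<and> emeasure M A < \<infinity> \<and> e > 0 \<and> lcm_nbhd M f A e \<subseteq> S)) \<longleftrightarrow> P S" for S
  proof safe
    assume S: "S \<subseteq> L0 M" and *: "\<forall>f\<in>S. \<exists>A e. A \<in> sets M \<and> emeasure M A < \<infinity> \<and> e > 0 \<and> lcm_nbhd M f A e \<subseteq> S"
    show "P S" unfolding P_def
    proof (intro conjI ballI S)
      fix f assume f: "f \<in> S"
      with * obtain A e where "A \<in> sets M" "emeasure M A < \<infinity>" "e > 0" and sub: "lcm_nbhd M f A e \<subseteq> S" by blast
      moreover have "f \<in> L0 M" using f S by auto
      ultimately obtain \<eta> where "\<eta> > 0" "\<And>g. g \<in> L0 M \<Longrightarrow> rho (\<lambda>x. g x - f x) < \<eta> \<Longrightarrow> g \<in> lcm_nbhd M f A e"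
        using lcm_nbhd_contains_rho_ball by metis
      with sub show "\<exists>\<epsilon>>0. \<forall>g\<in>L0 M. rho (\<lambda>x. g x - f x) < \<epsilon> \<longrightarrow> g \<in> S" by blast
    qed
  next
    fix f assume P: "P S" and f: "f \<in> S"
    then obtain \<epsilon> where \<epsilon>: "\<epsilon> > 0" and sub: "\<forall>g\<in>L0 M. rho (\<lambda>x. g x - f x) < \<epsilon> \<longrightarrow> g \<in> S"
      by (auto simp: P_def)
    from \<epsilon> obtain A e where Ae: "A \<in> sets M" "emeasure M A < \<infinity>" "e > 0"
      and nb: "\<And>f g. f \<in> L0 M \<Longrightarrow> g \<in> lcm_nbhd M f A e \<Longrightarrow> rho (\<lambda>x. g x - f x) < \<epsilon>"
      using rho_ball_contains_lcm_nbhd by metis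
    have "f \<in> L0 M" using P f by (auto simp: P_def)
    then have "lcm_nbhd M f A e \<subseteq> S" using nb sub by (auto simp: lcm_nbhd_def)
    with Ae show "\<exists>A e. A \<in> sets M \<and> emeasure M A < \<infinity> \<and> e > 0 \<and> lcm_nbhd M f A e \<subseteq> S" by blast
  qed (auto simp: P_def)
  have "istopology P"
    unfolding istopology_def
  proof (intro conjI allI impI)
    fix S T assume S: "P S" and T: "P T"
    show "P (S \<inter> T)" unfolding P_def
    proof (intro conjI ballI)
      fix f assume f: "f \<in> S \<inter> T"
      obtain a where a: "a > 0" "\<forall>g\<in>L0 M. rho (\<lambda>x. g x - f x) < a \<longrightarrow> g \<in> S"
        using S f unfolding P_def by blast
      obtain b where b: "b > 0" "\<forall>g\<in>L0 M. rho (\<lambda>x. g x - f x) < b \<longrightarrow> g \<in> T"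
        using T f unfolding P_def by blast
      show "\<exists>\<epsilon>>0. \<forall>g\<in>L0 M. rho (\<lambda>x. g x - f x) < \<epsilon> \<longrightarrow> g \<in> S \<inter> T"
        using a b by (intro exI[of _ "min a b"]) auto
    qed (use S in \<open>auto simp: P_def\<close>)
  next
    fix K assume K: "\<forall>S\<in>K. P S"
    show "P (\<Union>K)" unfolding P_def
    proof (intro conjI ballI)
      fix f assume "f \<in> \<Union>K"
      then obtain S where "S \<in> K" "f \<in> S" by blast
      with K show "\<exists>\<epsilon>>0. \<forall>g\<in>L0 M. rho (\<lambda>x. g x - f x) < \<epsilon> \<longrightarrow> g \<in> \<Union>K"
        unfolding P_def by (metis UnionI)
    qed (use K in \<open>auto simp: P_def\<close>)
  qed
  then have "openin (lcm_topology M) = P"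
    unfolding lcm_topology_def eq by (rule topology_inverse')
  then show ?thesis by (simp add: P_def)
qed

lemma openin_lcm_rho_ball:
  assumes "f \<in> L0 M"
  shows "openin (lcm_topology M) {g \<in> L0 M. rho (\<lambda>x. g x - f x) < \<epsilon>}"
  unfolding openin_lcm_iff
proof (intro conjI ballI)
  fix g assume g: "g \<in> {g \<in> L0 M. rho (\<lambda>x. g x - f x) < \<epsilon>}"
  show "\<exists>\<delta>>0. \<forall>h\<in>L0 M. rho (\<lambda>x. h x - g x) < \<delta> \<longrightarrow> h \<in> {g \<in> L0 M. rho (\<lambda>x. g x - f x) < \<epsilon>}"
  proof (intro exI[of _ "\<epsilon> - rho (\<lambda>x. g x - f x)"] conjI ballI impI)
    fix h assume h: "h \<in> L0 M" "rho (\<lambda>x. h x - g x) < \<epsilon> - rho (\<lambda>x. g x - f x)"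
    then show "h \<in> {g \<in> L0 M. rho (\<lambda>x. g x - f x) < \<epsilon>}"
      using rho_triangle[of h g f] g assms by auto
  qed (use g in auto)
qed auto

end

section \<open>The relaxed form and its Luxemburg seminorm\<close>

lemma L2_subset_L0: "f \<in> L2 M \<Longrightarrow> f \<in> L0 M"
  by (simp add: L2_def L0_def)

lemma L2_lincomb:
  assumes "f \<in> L2 M" "g \<in> L2 M"
  shows "(\<lambda>x. a * f x + b * g x) \<in> L2 M"
proof -
  have [measurable]: "f \<in> borel_measurable M" "g \<in> borel_measurable M"
    and i: "integrable M (\<lambda>x. (f x)\<^sup>2)" "integrable M (\<lambda>x. (g x)\<^sup>2)"
    using assms by (auto simp: L2_def)
  have "integrable M (\<lambda>x. 2 * a\<^sup>2 * (f x)\<^sup>2 + 2 * b\<^sup>2 * (g x)\<^sup>2)"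
    using i by (intro Bochner_Integration.integrable_add integrable_mult_right)
  then have "integrable M (\<lambda>x. (a * f x + b * g x)\<^sup>2)"
  proof (rule Bochner_Integration.integrable_bound)
    have "(a * f x + b * g x)\<^sup>2 \<le> 2 * a\<^sup>2 * (f x)\<^sup>2 + 2 * b\<^sup>2 * (g x)\<^sup>2" for x
      using zero_le_power2[of "a * f x - b * g x"] by (simp add: power2_eq_square algebra_simps)
    then show "AE x in M. norm ((a * f x + b * g x)\<^sup>2) \<le> norm (2 * a\<^sup>2 * (f x)\<^sup>2 + 2 * b\<^sup>2 * (g x)\<^sup>2)"
      by (intro AE_I2) (auto intro: order_trans)
  qed simp
  then show ?thesis by (simp add: L2_def)
qed

lemma lipschitz_measurable:
  fixes C :: "real \<Rightarrow> real"
  assumes "\<And>s t. \<bar>C s - C t\<bar> \<le> \<bar>s - t\<bar>"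
  shows "C \<in> borel_measurable borel"
proof -
  have "1-lipschitz_on UNIV C" using assms by (auto simp: lipschitz_on_def dist_real_def)
  then show ?thesis by (intro borel_measurable_continuous_onI lipschitz_on_continuous_on)
qed

lemma L2_contraction:
  fixes C :: "real \<Rightarrow> real"
  assumes f: "f \<in> L2 M" and C: "\<And>s t. \<bar>C s - C t\<bar> \<le> \<bar>s - t\<bar>" "C 0 = 0"
  shows "(\<lambda>x. C (f x)) \<in> L2 M"
proof -
  have [measurable]: "f \<in> borel_measurable M" "C \<in> borel_measurable borel"
    and i: "integrable M (\<lambda>x. (f x)\<^sup>2)"
    using f lipschitz_measurable[OF C(1)] by (auto simp: L2_def)
  have "\<bar>C s\<bar> \<le> \<bar>s\<bar>" for s using C(1)[of s 0] C(2) by simp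
  then have "(C s)\<^sup>2 \<le> s\<^sup>2" for s by (simp add: abs_le_square_iff)
  then have "integrable M (\<lambda>x. (C (f x))\<^sup>2)"
    by (intro Bochner_Integration.integrable_bound[OF i]) auto
  then show ?thesis by (simp add: L2_def)
qed

lemma ennreal_le_if_le_all_greater:
  fixes x y :: ennreal
  assumes "\<And>z. y < z \<Longrightarrow> x \<le> z"
  shows "x \<le> y"
  using assms by (meson dense leD leI)

section \<open>Convexity, contraction and lower semicontinuity of the relaxed form\<close>

locale weighted_dirichlet = weighted_measure +
  fixes E :: "('a \<Rightarrow> real) \<Rightarrow> ennreal"
  assumes form: "nonlinear_dirichlet_form M E"
begin

abbreviation "Ee \<equiv> E_e M E"
abbreviation "D \<equiv> dom_M M E"
abbreviation "N \<equiv> Le_norm M E"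

lemma E_convex:
  "f \<in> L2 M \<Longrightarrow> g \<in> L2 M \<Longrightarrow> 0 \<le> t \<Longrightarrow> t \<le> 1 \<Longrightarrow>
   E (\<lambda>x. t * f x + (1 - t) * g x) \<le> ennreal t * E f + ennreal (1 - t) * E g"
  and E_uminus: "f \<in> L2 M \<Longrightarrow> E (\<lambda>x. - f x) = E f"
  and E_zero: "E (\<lambda>x. 0) = 0"
  and E_contraction2: "f \<in> L2 M \<Longrightarrow> g \<in> L2 M \<Longrightarrow> (\<And>s t. \<bar>C s - C t\<bar> \<le> \<bar>s - t\<bar>) \<Longrightarrow> C 0 = 0 \<Longrightarrow>
   E (\<lambda>x. f x + C (g x)) + E (\<lambda>x. f x - C (g x)) \<le> E (\<lambda>x. f x + g x) + E (\<lambda>x. f x - g x)"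
  using form unfolding nonlinear_dirichlet_form_def by blast+

lemma zero_L2: "(\<lambda>x. 0) \<in> L2 M"
  by (simp add: L2_def)

text \<open>With \<open>f = 0\<close> in the contraction property, symmetry gives
  \<open>2 E(C g) \<le> 2 E(g)\<close>. The factor is removed by contradiction, since the values are
  extended reals.\<close>

lemma E_contraction:
  assumes g: "g \<in> L2 M" and C: "\<And>s t. \<bar>C s - C t\<bar> \<le> \<bar>s - t\<bar>" "C 0 = 0"
  shows "E (\<lambda>x. C (g x)) \<le> E g"
proof (rule ccontr)
  assume "\<not> ?thesis"
  then have "E g < E (\<lambda>x. C (g x))" by simp
  then have "E g + E g < E (\<lambda>x. C (g x)) + E (\<lambda>x. C (g x))" by (intro add_strict_mono)
  moreover have "E (\<lambda>x. C (g x)) + E (\<lambda>x. C (g x)) \<le> E g + E g"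
    using E_contraction2[OF zero_L2 g C] E_uminus[OF g] E_uminus[OF L2_contraction[OF g C]] by simp
  ultimately show False by simp
qed

lemma Ee_le_E: "g \<in> L2 M \<Longrightarrow> Ee g \<le> E g"
  unfolding E_e_def by (rule SUP_least, rule INF_lower2[of g]) (simp_all add: E_ext_def)

text \<open>Lower semicontinuity as closedness of sublevel sets: an open neighbourhood of
  \<open>f\<close> contains such a \<open>g\<close> and is then a neighbourhood of \<open>g\<close>,
  so its infimum is at most \<open>Ee g\<close>.\<close>

lemma Ee_le_closed:
  assumes f: "f \<in> L0 M" and *: "\<And>\<epsilon>. \<epsilon> > 0 \<Longrightarrow> \<exists>g\<in>L0 M. rho (\<lambda>x. g x - f x) < \<epsilon> \<and> Ee g \<le> a"
  shows "Ee f \<le> a"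
  unfolding E_e_def[of _ _ f]
proof (rule SUP_least)
  fix U assume "U \<in> {U. openin (lcm_topology M) U \<and> f \<in> U}"
  then have U: "openin (lcm_topology M) U" "f \<in> U" by auto
  then obtain \<epsilon> where "\<epsilon> > 0" "\<forall>g\<in>L0 M. rho (\<lambda>x. g x - f x) < \<epsilon> \<longrightarrow> g \<in> U"
    unfolding openin_lcm_iff by blast
  with *[of \<epsilon>] obtain g where g: "g \<in> U" "Ee g \<le> a" by blast
  have "(INF g\<in>U. E_ext M E g) \<le> Ee g"
    unfolding E_e_def using U g by (intro SUP_upper) auto
  with g show "(INF g\<in>U. E_ext M E g) \<le> a" by simp
qed

text \<open>The \<open>rho\<close>-ball around \<open>f\<close> is one of the neighbourhoods in the
  supremum, so its infimum lies below \<open>a\<close>; a finite value of \<open>E_ext\<close>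
  forces the approximant into \<open>L2\<close>.\<close>

lemma Ee_less_approx:
  assumes "f \<in> L0 M" "Ee f < a" "\<epsilon> > 0"
  obtains g where "g \<in> L2 M" "rho (\<lambda>x. g x - f x) < \<epsilon>" "E g < a"
proof -
  let ?U = "{g \<in> L0 M. rho (\<lambda>x. g x - f x) < \<epsilon>}"
  have "(INF g\<in>?U. E_ext M E g) \<le> Ee f"
    unfolding E_e_def using assms openin_lcm_rho_ball[OF assms(1)] by (intro SUP_upper) auto
  then have "(INF g\<in>?U. E_ext M E g) < a" using assms(2) by simp
  then obtain g where "g \<in> ?U" "E_ext M E g < a" by (auto simp: INF_less_iff)
  then show thesis using that[of g] by (auto simp: E_ext_def split: if_splits)
qed

text \<open>\<open>L2\<close> approximants of \<open>f\<close> and \<open>g\<close> are combined: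
  \<open>E\<close> is convex there and the combination stays \<open>rho\<close>-close. The real
  bounds \<open>a\<close> and \<open>b\<close> keep the arithmetic finite, and \<open>e\<close>
  gives room for strict approximation.\<close>

lemma Ee_convex:
  assumes f: "f \<in> L0 M" and g: "g \<in> L0 M" and t: "0 \<le> t" "t \<le> 1"
    and a: "0 \<le> a" "Ee f \<le> ennreal a" and b: "0 \<le> b" "Ee g \<le> ennreal b"
  shows "Ee (\<lambda>x. t * f x + (1 - t) * g x) \<le> ennreal (t * a + (1 - t) * b)"
proof (rule ennreal_le_epsilon)
  fix e :: real assume e: "e > 0"
  let ?h = "\<lambda>f g x. t * f x + (1 - t) * g x"
  have "Ee (?h f g) \<le> ennreal (t * a + (1 - t) * b + e)"
  proof (rule Ee_le_closed)
    show "?h f g \<in> L0 M" using f g by (simp add: L0_def)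
    fix \<epsilon> :: real assume \<epsilon>: "\<epsilon> > 0"
    have "Ee f < ennreal (a + e)" using a e by (intro le_less_trans[OF a(2)] ennreal_lessI) auto
    from Ee_less_approx[OF f this half_gt_zero[OF \<epsilon>]] obtain f'
      where f': "f' \<in> L2 M" "rho (\<lambda>x. f' x - f x) < \<epsilon>/2" "E f' < ennreal (a + e)" .
    have "Ee g < ennreal (b + e)" using b e by (intro le_less_trans[OF b(2)] ennreal_lessI) auto
    from Ee_less_approx[OF g this half_gt_zero[OF \<epsilon>]] obtain g'
      where g': "g' \<in> L2 M" "rho (\<lambda>x. g' x - g x) < \<epsilon>/2" "E g' < ennreal (b + e)" .
    have L0: "f' \<in> L0 M" "g' \<in> L0 M" using f' g' L2_subset_L0 by auto
    have "rho (\<lambda>x. t * (f' x - f x) + (1 - t) * (g' x - g x))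
        \<le> rho (\<lambda>x. t * (f' x - f x)) + rho (\<lambda>x. (1 - t) * (g' x - g x))"
      using f g L0 by (intro rho_add_le) (auto simp: L0_def)
    also have "\<dots> \<le> rho (\<lambda>x. f' x - f x) + rho (\<lambda>x. g' x - g x)"
      using f g L0 t by (intro add_mono rho_scale_le) (auto simp: L0_def)
    also have "\<dots> < \<epsilon>" using f' g' by simp
    finally have r: "rho (\<lambda>x. ?h f' g' x - ?h f g x) < \<epsilon>" by (simp add: algebra_simps)
    have "Ee (?h f' g') \<le> E (?h f' g')"
      by (intro Ee_le_E L2_lincomb f' g')
    also have "\<dots> \<le> ennreal t * E f' + ennreal (1 - t) * E g'"
      by (intro E_convex f' g' t)
    also have "\<dots> \<le> ennreal t * ennreal (a + e) + ennreal (1 - t) * ennreal (b + e)"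
      using f' g' by (intro add_mono mult_left_mono) auto
    also have "\<dots> = ennreal (t * (a + e) + (1 - t) * (b + e))"
      using t a b e by (simp add: ennreal_mult'' ennreal_plus)
    also have "t * (a + e) + (1 - t) * (b + e) = t * a + (1 - t) * b + e"
      by (simp add: algebra_simps)
    finally have "Ee (?h f' g') \<le> ennreal (t * a + (1 - t) * b + e)" .
    with r show "\<exists>h\<in>L0 M. rho (\<lambda>x. h x - ?h f g x) < \<epsilon> \<and> Ee h \<le> ennreal (t * a + (1 - t) * b + e)"
      using L0 by (intro bexI[of _ "?h f' g'"]) (auto simp: L0_def)
  qed
  then show "Ee (?h f g) \<le> ennreal (t * a + (1 - t) * b) + ennreal e"
    using t a b e by (simp add: ennreal_plus)
qed

text \<open>Composition with \<open>C\<close> does not increase \<open>rho\<close>-distances, so it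
  maps \<open>L2\<close> approximants of \<open>f\<close> to approximants of \<open>C f\<close>
  without raising \<open>E\<close>.\<close>

lemma Ee_contraction:
  assumes f: "f \<in> L0 M" and C: "\<And>s t. \<bar>C s - C t\<bar> \<le> \<bar>s - t\<bar>" "C 0 = 0"
  shows "Ee (\<lambda>x. C (f x)) \<le> Ee f"
proof (rule ennreal_le_if_le_all_greater)
  fix z assume z: "Ee f < z"
  have Cm [measurable]: "C \<in> borel_measurable borel" by (rule lipschitz_measurable[OF C(1)])
  show "Ee (\<lambda>x. C (f x)) \<le> z"
  proof (rule Ee_le_closed)
    show "(\<lambda>x. C (f x)) \<in> L0 M" using f by (simp add: L0_def)
    fix \<epsilon> :: real assume \<epsilon>: "\<epsilon> > 0"
    obtain g where g: "g \<in> L2 M" "rho (\<lambda>x. g x - f x) < \<epsilon>" "E g < z"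
      using Ee_less_approx[OF f z \<epsilon>] .
    have gL: "g \<in> L0 M" using g L2_subset_L0 by auto
    have "rho (\<lambda>x. C (g x) - C (f x)) \<le> rho (\<lambda>x. g x - f x)"
      using f gL C(1) by (intro rho_mono) (auto simp: L0_def)
    moreover have "Ee (\<lambda>x. C (g x)) \<le> z"
      using Ee_le_E[OF L2_contraction[OF g(1) C]] E_contraction[OF g(1) C] g(3) by simp
    ultimately show "\<exists>h\<in>L0 M. rho (\<lambda>x. h x - C (f x)) < \<epsilon> \<and> Ee h \<le> z"
      using g L2_subset_L0[OF L2_contraction[OF g(1) C]] by (intro bexI[of _ "\<lambda>x. C (g x)"]) auto
  qed
qed

lemma zero_L0: "(\<lambda>x. 0) \<in> L0 M"
  by (simp add: L0_def)

lemma Ee_zero: "Ee (\<lambda>x. 0) = 0"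
  using Ee_le_E[OF zero_L2] E_zero by simp

lemma Ee_scale:
  assumes "f \<in> L0 M" "0 \<le> t" "t \<le> 1" "0 \<le> a" "Ee f \<le> ennreal a"
  shows "Ee (\<lambda>x. t * f x) \<le> ennreal (t * a)"
  using Ee_convex[OF assms(1) zero_L0 assms(2-5), of 0] Ee_zero by simp

section \<open>The domain \<open>M(E_e)\<close> and its Luxemburg seminorm\<close>

lemma L0_divide: "f \<in> L0 M \<Longrightarrow> (\<lambda>x. f x / l) \<in> L0 M"
  by (simp add: L0_def)

text \<open>By convexity and \<open>Ee 0 = 0\<close>, a single bound
  \<open>Ee (f / l) \<le> 1\<close> forces the linear decay \<open>Ee (t f) \<le> t l\<close> for
  \<open>0 < t < 1/l\<close>. Thus the infimum defining the seminorm runs over a nonempty set on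
  \<open>D\<close>.\<close>

lemma dom_iff: "f \<in> D \<longleftrightarrow> f \<in> L0 M \<and> (\<exists>l>0. Ee (\<lambda>x. f x / l) \<le> 1)"
proof safe
  assume f: "f \<in> D"
  then show "f \<in> L0 M" by (simp add: dom_M_def)
  have "((\<lambda>t. Ee (\<lambda>x. t * f x)) \<longlongrightarrow> 0) (at_right 0)"
    using f by (simp add: dom_M_def)
  then have "eventually (\<lambda>t. Ee (\<lambda>x. t * f x) < 1) (at_right 0)"
    by (rule order_tendstoD) simp
  then obtain b :: real where b: "b > 0" "\<And>t. 0 < t \<Longrightarrow> t < b \<Longrightarrow> Ee (\<lambda>x. t * f x) < 1"
    using eventually_at_right[of "0::real" 1] by auto
  have "Ee (\<lambda>x. (b/2) * f x) < 1" by (rule b(2)) (use b(1) in auto)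
  then show "\<exists>l>0. Ee (\<lambda>x. f x / l) \<le> 1"
    using b(1) by (intro exI[of _ "2/b"]) (auto simp: mult.commute)
next
  fix l :: real assume f: "f \<in> L0 M" and l: "l > 0" and le: "Ee (\<lambda>x. f x / l) \<le> 1"
  have "((\<lambda>t. Ee (\<lambda>x. t * f x)) \<longlongrightarrow> 0) (at_right 0)"
  proof (rule tendsto_sandwich[where f = "\<lambda>_. 0" and h = "\<lambda>t. ennreal (t * l)"])
    have "((\<lambda>t::real. ennreal (t * l)) \<longlongrightarrow> ennreal (0 * l)) (at_right 0)"
      by (intro tendsto_intros)
    then show "((\<lambda>t::real. ennreal (t * l)) \<longlongrightarrow> 0) (at_right 0)" by simp
    have "eventually (\<lambda>t::real. 0 < t \<and> t < 1 / l) (at_right 0)"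
      using l by (auto simp: eventually_at_right[of "0::real" 1] intro!: exI[of _ "1/l"])
    then show "eventually (\<lambda>t. Ee (\<lambda>x. t * f x) \<le> ennreal (t * l)) (at_right 0)"
    proof eventually_elim
      case (elim t)
      then show ?case
        using Ee_scale[OF L0_divide[OF f, of l], of "t * l" 1] le l by (simp add: field_simps)
    qed
  qed auto
  with f show "f \<in> D" by (simp add: dom_M_def)
qed

lemma dom_L0: "f \<in> D \<Longrightarrow> f \<in> L0 M"
  by (simp add: dom_M_def)

lemma domI: "f \<in> L0 M \<Longrightarrow> l > 0 \<Longrightarrow> Ee (\<lambda>x. f x / l) \<le> 1 \<Longrightarrow> f \<in> D"
  by (auto simp: dom_iff)

lemma N_le: "l > 0 \<Longrightarrow> Ee (\<lambda>x. f x / l) \<le> 1 \<Longrightarrow> N f \<le> l"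
  unfolding Le_norm_def by (intro cInf_lower bdd_belowI[of _ 0]) auto

lemma N_nonneg: "f \<in> D \<Longrightarrow> 0 \<le> N f"
  unfolding Le_norm_def by (intro cInf_greatest) (auto simp: dom_iff)

text \<open>Some \<open>m < l\<close> is admissible, and passing from \<open>m\<close> to
  \<open>l\<close> multiplies by \<open>m / l < 1\<close>, under which convexity preserves the bound
  1. The strict inequality avoids asking for an attained infimum.\<close>

lemma N_less:
  assumes f: "f \<in> D" and l: "N f < l"
  shows "Ee (\<lambda>x. f x / l) \<le> 1"
proof -
  have "{l. l > 0 \<and> Ee (\<lambda>x. f x / l) \<le> 1} \<noteq> {}" using f by (auto simp: dom_iff)
  from cInf_lessD[OF this] l obtain m where m: "m > 0" "Ee (\<lambda>x. f x / m) \<le> 1" "m < l"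
    unfolding Le_norm_def by blast
  have "Ee (\<lambda>x. m / l * (f x / m)) \<le> ennreal (m / l * 1)"
    using m by (intro Ee_scale L0_divide dom_L0[OF f]) auto
  also have "\<dots> \<le> 1" using m by (simp add: ennreal_le_1)
  finally show ?thesis using m by simp
qed

lemma N_leI:
  assumes "\<And>l. l > a \<Longrightarrow> l > 0 \<and> Ee (\<lambda>x. f x / l) \<le> 1"
  shows "N f \<le> a"
proof (rule dense_ge)
  fix l assume "l > a"
  then show "N f \<le> l" using assms[of l] N_le[of l f] by simp
qed

lemma zero_dom: "(\<lambda>x. 0) \<in> D" and N_zero: "N (\<lambda>x. 0) = 0"
proof -
  show "(\<lambda>x. 0) \<in> D" by (rule domI[OF zero_L0, of 1]) (auto simp: Ee_zero)
  then show "N (\<lambda>x. 0) = 0" by (intro antisym N_leI N_nonneg) (auto simp: Ee_zero)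
qed

text \<open>The Luxemburg argument: \<open>(f + g) / (l + m)\<close> is the convex combination of
  \<open>f / l\<close> and \<open>g / m\<close> with weights \<open>l / (l + m)\<close> and
  \<open>m / (l + m)\<close>.\<close>

lemma
  assumes f: "f \<in> D" and g: "g \<in> D"
  shows dom_add: "(\<lambda>x. f x + g x) \<in> D"
    and N_add: "N (\<lambda>x. f x + g x) \<le> N f + N g"
proof -
  have key: "Ee (\<lambda>x. (f x + g x) / (l + m)) \<le> 1" if l: "l > N f" and m: "m > N g" for l m
  proof -
    have lm: "l > 0" "m > 0" using l m N_nonneg[OF f] N_nonneg[OF g] by auto
    have "l / (l + m) * (f x / l) + (1 - l / (l + m)) * (g x / m) = (f x + g x) / (l + m)" for x
    proof -
      have "1 - l / (l + m) = m / (l + m)" using lm by (simp add: field_simps)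
      then show ?thesis using lm by (simp add: add_divide_distrib)
    qed
    then show ?thesis
      using Ee_convex[OF L0_divide[OF dom_L0[OF f], of l] L0_divide[OF dom_L0[OF g], of m], of "l / (l + m)" 1 1]
        N_less[OF f l] N_less[OF g m] lm by simp
  qed
  have L: "(\<lambda>x. f x + g x) \<in> L0 M" using f g[THEN dom_L0] dom_L0[OF f] by (simp add: L0_def)
  show "(\<lambda>x. f x + g x) \<in> D"
    using key[of "N f + 1" "N g + 1"] N_nonneg[OF f] N_nonneg[OF g]
    by (intro domI[OF L, of "N f + 1 + (N g + 1)"]) auto
  show "N (\<lambda>x. f x + g x) \<le> N f + N g"
  proof (rule N_leI)
    fix l assume l: "l > N f + N g"
    define e where "e = (l - N f - N g) / 2"
    have "e > 0" using l by (simp add: e_def)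
    then have "Ee (\<lambda>x. (f x + g x) / ((N f + e) + (N g + e))) \<le> 1" by (intro key) auto
    moreover have "(N f + e) + (N g + e) = l" by (simp add: e_def field_simps)
    ultimately show "l > 0 \<and> Ee (\<lambda>x. (f x + g x) / l) \<le> 1"
      using l N_nonneg[OF f] N_nonneg[OF g] by simp
  qed
qed

lemma
  assumes f: "f \<in> D" and c: "c > 0"
  shows dom_scale: "(\<lambda>x. c * f x) \<in> D" and N_scale: "N (\<lambda>x. c * f x) \<le> c * N f"
proof -
  have key: "Ee (\<lambda>x. c * f x / l) \<le> 1" if "l > c * N f" for l
    using N_less[OF f, of "l / c"] that c by (simp add: pos_less_divide_eq mult.commute)
  have cN: "c * N f \<ge> 0" using c N_nonneg[OF f] by simp
  have L: "(\<lambda>x. c * f x) \<in> L0 M" using dom_L0[OF f] by (simp add: L0_def)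
  show "(\<lambda>x. c * f x) \<in> D" by (rule domI[OF L _ key, of "c * N f + 1"]) (use cN in auto)
  show "N (\<lambda>x. c * f x) \<le> c * N f" by (rule N_leI) (use key cN in auto)
qed

text \<open>The rescaled map taking \<open>s\<close> to \<open>C (l s) / l\<close> is again
  1-Lipschitz and fixes 0, so \<open>Ee_contraction\<close> applies to \<open>f / l\<close>.\<close>

lemma
  assumes f: "f \<in> D" and C: "\<And>s t. \<bar>C s - C t\<bar> \<le> \<bar>s - t\<bar>" "C 0 = 0"
  shows dom_contraction: "(\<lambda>x. C (f x)) \<in> D" and N_contraction: "N (\<lambda>x. C (f x)) \<le> N f"
proof -
  have key: "Ee (\<lambda>x. C (f x) / l) \<le> 1" if l: "l > N f" for l
  proof -
    have l0: "l > 0" using l N_nonneg[OF f] by simp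
    have "\<bar>C (l * s) / l - C (l * t) / l\<bar> \<le> \<bar>s - t\<bar>" for s t
    proof -
      have "\<bar>C (l * s) / l - C (l * t) / l\<bar> = \<bar>C (l * s) - C (l * t)\<bar> / l"
        using l0 by (simp add: abs_divide flip: diff_divide_distrib)
      also have "\<dots> \<le> \<bar>l * s - l * t\<bar> / l" using l0 by (intro divide_right_mono C) auto
      also have "\<dots> = \<bar>s - t\<bar>" using l0 by (simp add: abs_mult flip: right_diff_distrib)
      finally show ?thesis .
    qed
    then have "Ee (\<lambda>x. C (l * (f x / l)) / l) \<le> Ee (\<lambda>x. f x / l)"
      by (rule Ee_contraction[where C = "\<lambda>s. C (l * s) / l", OF L0_divide[OF dom_L0[OF f]]]) (simp add: C(2))
    with N_less[OF f l] l0 show ?thesis by simp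
  qed
  have L: "(\<lambda>x. C (f x)) \<in> L0 M"
    using dom_L0[OF f] lipschitz_measurable[OF C(1)] by (simp add: L0_def)
  show "(\<lambda>x. C (f x)) \<in> D" by (rule domI[OF L _ key, of "N f + 1"]) (use N_nonneg[OF f] in auto)
  show "N (\<lambda>x. C (f x)) \<le> N f" by (rule N_leI) (use key N_nonneg[OF f] in auto)
qed

lemma dom_uminus: "f \<in> D \<Longrightarrow> (\<lambda>x. - f x) \<in> D"
  and N_uminus_le: "f \<in> D \<Longrightarrow> N (\<lambda>x. - f x) \<le> N f"
  by (rule dom_contraction[of f uminus] N_contraction[of f uminus]; simp)+

lemma
  assumes "f \<in> D" "g \<in> D"
  shows dom_diff: "(\<lambda>x. f x - g x) \<in> D" and N_diff: "N (\<lambda>x. f x - g x) \<le> N f + N g"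
  using dom_add[OF assms(1) dom_uminus[OF assms(2)]] N_add[OF assms(1) dom_uminus[OF assms(2)]]
    N_uminus_le[OF assms(2)] by auto

lemma N_minus_commute:
  assumes "f \<in> D" "g \<in> D"
  shows "N (\<lambda>x. f x - g x) = N (\<lambda>x. g x - f x)"
  using N_uminus_le[OF dom_diff[OF assms]] N_uminus_le[OF dom_diff[OF assms(2,1)]] by simp

lemma N_triangle:
  assumes "f \<in> D" "g \<in> D" "h \<in> D"
  shows "N (\<lambda>x. f x - h x) \<le> N (\<lambda>x. f x - g x) + N (\<lambda>x. g x - h x)"
  using N_add[OF dom_diff[OF assms(1,2)] dom_diff[OF assms(2,3)]] by simp

text \<open>Lower semicontinuity of the seminorm under \<open>rho\<close>-approximation, used to
  identify limits both for completeness and for the closed graph. Strictness of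
  \<open>N g < l\<close> gives \<open>Ee (g / l) \<le> 1\<close>, and sublevel sets are
  closed.\<close>

lemma
  assumes f: "f \<in> L0 M" and l: "l > 0"
    and *: "\<And>\<epsilon>. \<epsilon> > 0 \<Longrightarrow> \<exists>g\<in>D. rho (\<lambda>x. g x - f x) < \<epsilon> \<and> N g < l"
  shows dom_closed: "f \<in> D" and N_lsc: "N f \<le> l"
proof -
  have "Ee (\<lambda>x. f x / l) \<le> 1"
  proof (rule Ee_le_closed[OF L0_divide[OF f]])
    fix \<epsilon> :: real assume \<epsilon>: "\<epsilon> > 0"
    \<comment> \<open>Division by \<open>l\<close> enlarges \<open>rho\<close> at most by this
      factor; it compensates for the missing homogeneity.\<close>
    define m where "m = max 1 \<bar>1 / l\<bar>"
    have m: "m > 0" unfolding m_def by (rule less_le_trans[OF zero_less_one max.cobounded1])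
    obtain g where g: "g \<in> D" "rho (\<lambda>x. g x - f x) < \<epsilon> / m" "N g < l"
      using *[OF divide_pos_pos[OF \<epsilon> m]] by blast
    have "rho (\<lambda>x. 1 / l * (g x - f x)) \<le> m * rho (\<lambda>x. g x - f x)"
      unfolding m_def using f dom_L0[OF g(1)] by (intro rho_cmult_le) (simp add: L0_def)
    also have "\<dots> < \<epsilon>" using g(2) m by (simp add: field_simps)
    finally have "rho (\<lambda>x. g x / l - f x / l) < \<epsilon>" by (simp add: diff_divide_distrib)
    then show "\<exists>g\<in>L0 M. rho (\<lambda>x. g x - f x / l) < \<epsilon> \<and> Ee g \<le> 1"
      by (intro bexI[of _ "\<lambda>x. g x / l"] conjI N_less g L0_divide dom_L0)
  qed
  then show "f \<in> D" "N f \<le> l" by (rule domI[OF f l], rule N_le[OF l])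
qed

end

section \<open>Continuity of the embedding modulo constants\<close>

lemma openin_L0_quot_iff:
  "openin (L0_quot_topology M) U \<longleftrightarrow>
     U \<subseteq> cls M ` L0 M \<and> openin (lcm_topology M) {f \<in> L0 M. cls M f \<in> U}"
proof -
  have "istopology (\<lambda>U. U \<subseteq> cls M ` L0 M \<and> openin (lcm_topology M) {f \<in> L0 M. cls M f \<in> U})"
    unfolding istopology_def
  proof (intro conjI allI impI)
    fix S T assume S: "S \<subseteq> cls M ` L0 M \<and> openin (lcm_topology M) {f \<in> L0 M. cls M f \<in> S}"
      and T: "T \<subseteq> cls M ` L0 M \<and> openin (lcm_topology M) {f \<in> L0 M. cls M f \<in> T}"
    have "{f \<in> L0 M. cls M f \<in> S \<inter> T} = {f \<in> L0 M. cls M f \<in> S} \<inter> {f \<in> L0 M. cls M f \<in> T}" by auto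
    then show "openin (lcm_topology M) {f \<in> L0 M. cls M f \<in> S \<inter> T}" using S T by (simp add: openin_Int)
  next
    fix K assume K: "\<forall>S\<in>K. S \<subseteq> cls M ` L0 M \<and> openin (lcm_topology M) {f \<in> L0 M. cls M f \<in> S}"
    have "{f \<in> L0 M. cls M f \<in> \<Union>K} = (\<Union>S\<in>K. {f \<in> L0 M. cls M f \<in> S})" by auto
    then show "openin (lcm_topology M) {f \<in> L0 M. cls M f \<in> \<Union>K}" using K by auto
  qed blast+
  from fun_cong[OF topology_inverse'[OF this], of U] show ?thesis
    by (simp add: L0_quot_topology_def)
qed

lemma openin_Me_quot_iff:
  "openin (Me_quot_topology M E) U \<longleftrightarrow>
     U \<subseteq> cls M ` dom_M M E \<and>
     (\<forall>f\<in>dom_M M E. cls M f \<in> U \<longrightarrow>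
        (\<exists>r>0. \<forall>g\<in>dom_M M E. Le_norm M E (\<lambda>x. g x - f x) < r \<longrightarrow> cls M g \<in> U))"
proof -
  have "istopology (\<lambda>U. U \<subseteq> cls M ` dom_M M E \<and>
     (\<forall>f\<in>dom_M M E. cls M f \<in> U \<longrightarrow>
        (\<exists>r>0. \<forall>g\<in>dom_M M E. Le_norm M E (\<lambda>x. g x - f x) < r \<longrightarrow> cls M g \<in> U)))"
    (is "istopology ?P")
    unfolding istopology_def
  proof (rule conjI; (intro allI impI))
    fix S T assume S: "?P S" and T: "?P T"
    show "?P (S \<inter> T)"
    proof (intro conjI ballI impI)
      fix f assume f: "f \<in> dom_M M E" "cls M f \<in> S \<inter> T"
      obtain a where a: "a > 0" "\<forall>g\<in>dom_M M E. Le_norm M E (\<lambda>x. g x - f x) < a \<longrightarrow> cls M g \<in> S"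
        using S f by blast
      obtain b where b: "b > 0" "\<forall>g\<in>dom_M M E. Le_norm M E (\<lambda>x. g x - f x) < b \<longrightarrow> cls M g \<in> T"
        using T f by blast
      show "\<exists>r>0. \<forall>g\<in>dom_M M E. Le_norm M E (\<lambda>x. g x - f x) < r \<longrightarrow> cls M g \<in> S \<inter> T"
        using a b by (intro exI[of _ "min a b"]) auto
    qed (use S in blast)
  next
    fix K assume K: "\<forall>S\<in>K. ?P S"
    show "?P (\<Union>K)"
    proof (intro conjI ballI impI)
      fix f assume f: "f \<in> dom_M M E" "cls M f \<in> \<Union>K"
      then obtain S where S: "S \<in> K" "cls M f \<in> S" by blast
      then obtain r where "r > 0" "\<forall>g\<in>dom_M M E. Le_norm M E (\<lambda>x. g x - f x) < r \<longrightarrow> cls M g \<in> S"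
        using K f(1) by blast
      with S(1) show "\<exists>r>0. \<forall>g\<in>dom_M M E. Le_norm M E (\<lambda>x. g x - f x) < r \<longrightarrow> cls M g \<in> \<Union>K"
        by blast
    qed (use K in blast)
  qed
  from fun_cong[OF topology_inverse'[OF this], of U] show ?thesis
    by (simp add: Me_quot_topology_def)
qed

lemma topspace_Me_quot: "topspace (Me_quot_topology M E) = cls M ` dom_M M E"
proof
  show "topspace (Me_quot_topology M E) \<subseteq> cls M ` dom_M M E"
    using openin_topspace[of "Me_quot_topology M E"] unfolding openin_Me_quot_iff by simp
  have "openin (Me_quot_topology M E) (cls M ` dom_M M E)"
    unfolding openin_Me_quot_iff by (auto intro!: exI[of _ 1])
  then show "cls M ` dom_M M E \<subseteq> topspace (Me_quot_topology M E)" by (rule openin_subset)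
qed

lemma cls_shift: "cls M (\<lambda>x. f x - c) = cls M f"
proof -
  have "(\<exists>d. AE x in M. g x = f x - c + d) \<longleftrightarrow> (\<exists>d. AE x in M. g x = f x + d)" for g
  proof safe
    fix d assume "AE x in M. g x = f x - c + d"
    then have "AE x in M. g x = f x + (d - c)" by eventually_elim simp
    then show "\<exists>d. AE x in M. g x = f x + d" ..
  next
    fix d assume "AE x in M. g x = f x + d"
    then have "AE x in M. g x = f x - c + (d + c)" by eventually_elim simp
    then show "\<exists>d. AE x in M. g x = f x - c + d" ..
  qed
  then show ?thesis by (simp add: cls_def)
qed

lemma cls_eqD:
  assumes "f \<in> L0 M" "cls M f = cls M g"
  obtains c where "AE x in M. f x = g x + c"
proof -
  have "AE x in M. f x = f x + 0" by simp
  then have "f \<in> cls M f" using assms(1) unfolding cls_def by blast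
  with assms(2) that show thesis by (auto simp: cls_def)
qed

section \<open>Continuity of the embedding as an estimate at the origin\<close>

locale constant_kernel = weighted_dirichlet +
  assumes ker: "{f \<in> dom_M M E. Le_norm M E f = 0} = {f \<in> L0 M. \<exists>c::real. AE x in M. f x = c}"
begin

lemma const_dom: "(\<lambda>x. c) \<in> D" and N_const: "N (\<lambda>x. c) = 0"
proof -
  have "(\<lambda>x. c) \<in> {f \<in> L0 M. \<exists>c. AE x in M. f x = c}" by (auto simp: L0_def)
  with ker show "(\<lambda>x. c) \<in> D" "N (\<lambda>x. c) = 0" by blast+
qed

lemma dom_shift: "f \<in> D \<Longrightarrow> (\<lambda>x. f x - c) \<in> D"
  and N_shift_le: "f \<in> D \<Longrightarrow> N (\<lambda>x. f x - c) \<le> N f"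
  using dom_diff[OF _ const_dom] N_diff[OF _ const_dom, of f c] by (auto simp: N_const)

text \<open>The infimum of \<open>rho (f - c)\<close> over constants \<open>c\<close> is the
  quotient F-norm of the class of \<open>f\<close>; \<open>near\<close> says that it is below
  \<epsilon>.\<close>

definition near :: "real \<Rightarrow> ('a \<Rightarrow> real) \<Rightarrow> bool" where
  "near \<epsilon> f \<longleftrightarrow> (\<exists>c. rho (\<lambda>x. f x - c) < \<epsilon>)"

definition embedding_bound :: bool where
  "embedding_bound \<longleftrightarrow> (\<forall>\<epsilon>>0. \<exists>\<delta>>0. \<forall>f\<in>D. N f < \<delta> \<longrightarrow> near \<epsilon> f)"

lemma near_AE_shift:
  assumes "f \<in> L0 M" "g \<in> L0 M" "AE x in M. f x = g x + c" "near \<epsilon> g"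
  shows "near \<epsilon> f"
proof -
  from assms(4) obtain d where d: "rho (\<lambda>x. g x - d) < \<epsilon>" by (auto simp: near_def)
  have "rho (\<lambda>x. f x - (d + c)) = rho (\<lambda>x. g x - d)"
    by (rule rho_cong) (use assms in \<open>auto simp: L0_def elim!: AE_mp\<close>)
  with d show ?thesis by (metis near_def)
qed

text \<open>Forward: the preimage of a quotient ball is open and is tested at the class of 0.
  Backward: the estimate is applied to \<open>g - f\<close>, and the constant it yields is absorbed
  into the representative of \<open>g\<close>.\<close>

lemma continuous_iff_embedding_bound:
  "continuous_map (Me_quot_topology M E) (L0_quot_topology M) (\<lambda>C. C) \<longleftrightarrow> embedding_bound"
proof
  assume cont: "continuous_map (Me_quot_topology M E) (L0_quot_topology M) (\<lambda>C. C)"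
  show embedding_bound
    unfolding embedding_bound_def
  proof (intro allI impI)
    fix \<epsilon> :: real assume \<epsilon>: "\<epsilon> > 0"
    \<comment> \<open>\<open>near\<close> ignores added constants, so membership of a class in
      \<open>U\<close> can be read off any representative; the triangle inequality then makes the
      preimage of \<open>U\<close> open.\<close>
    define U where "U = cls M ` {f \<in> L0 M. near \<epsilon> f}"
    have U: "cls M f \<in> U \<longleftrightarrow> near \<epsilon> f" if f: "f \<in> L0 M" for f
    proof
      assume "cls M f \<in> U"
      then obtain g where g: "g \<in> L0 M" "near \<epsilon> g" "cls M f = cls M g" by (auto simp: U_def)
      then show "near \<epsilon> f" using near_AE_shift cls_eqD f by metis
    qed (use f in \<open>auto simp: U_def\<close>)
    have "openin (lcm_topology M) {f \<in> L0 M. cls M f \<in> U}"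
      unfolding openin_lcm_iff
    proof (intro conjI ballI)
      fix f assume "f \<in> {f \<in> L0 M. cls M f \<in> U}"
      then have f: "f \<in> L0 M" "near \<epsilon> f" by (auto simp: U)
      then obtain c where c: "rho (\<lambda>x. f x - c) < \<epsilon>" by (auto simp: near_def)
      show "\<exists>r>0. \<forall>g\<in>L0 M. rho (\<lambda>x. g x - f x) < r \<longrightarrow> g \<in> {f \<in> L0 M. cls M f \<in> U}"
      proof (intro exI[of _ "\<epsilon> - rho (\<lambda>x. f x - c)"] conjI ballI impI)
        fix g assume g: "g \<in> L0 M" "rho (\<lambda>x. g x - f x) < \<epsilon> - rho (\<lambda>x. f x - c)"
        have "rho (\<lambda>x. g x - c) \<le> rho (\<lambda>x. g x - f x) + rho (\<lambda>x. f x - c)"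
          by (rule rho_triangle[OF g(1) f(1)]) (simp add: L0_def)
        with g have "near \<epsilon> g" by (auto simp: near_def intro!: exI[of _ c])
        with g show "g \<in> {f \<in> L0 M. cls M f \<in> U}" by (simp add: U)
      qed (use c in auto)
    qed auto
    then have "openin (L0_quot_topology M) U"
      unfolding openin_L0_quot_iff by (auto simp: U_def)
    with cont have "openin (Me_quot_topology M E) {C \<in> cls M ` D. C \<in> U}"
      unfolding continuous_map_def topspace_Me_quot by blast
    moreover have "cls M (\<lambda>x. 0) \<in> {C \<in> cls M ` D. C \<in> U}"
      using zero_dom \<epsilon> U[OF zero_L0] by (auto simp: near_def intro!: exI[of _ 0])
    ultimately obtain r where "r > 0" "\<forall>g\<in>D. N (\<lambda>x. g x - 0) < r \<longrightarrow> cls M g \<in> {C \<in> cls M ` D. C \<in> U}"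
      using zero_dom unfolding openin_Me_quot_iff by blast
    then show "\<exists>\<delta>>0. \<forall>f\<in>D. N f < \<delta> \<longrightarrow> near \<epsilon> f"
      using U dom_L0 by (intro exI[of _ r]) auto
  qed
next
  assume *: embedding_bound
  have op: "openin (Me_quot_topology M E) {C \<in> cls M ` D. C \<in> U}" if U: "openin (L0_quot_topology M) U" for U
    unfolding openin_Me_quot_iff
  proof (intro conjI ballI impI)
    fix f assume f: "f \<in> D" "cls M f \<in> {C \<in> cls M ` D. C \<in> U}"
    from U have "openin (lcm_topology M) {f \<in> L0 M. cls M f \<in> U}" by (simp add: openin_L0_quot_iff)
    then obtain \<epsilon> where \<epsilon>: "\<epsilon> > 0" "\<forall>g\<in>L0 M. rho (\<lambda>x. g x - f x) < \<epsilon> \<longrightarrow> g \<in> {f \<in> L0 M. cls M f \<in> U}"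
      using f dom_L0 unfolding openin_lcm_iff by blast
    with * obtain \<delta> where \<delta>: "\<delta> > 0" "\<forall>f\<in>D. N f < \<delta> \<longrightarrow> near \<epsilon> f"
      unfolding embedding_bound_def by blast
    have "cls M g \<in> U" if g: "g \<in> D" "N (\<lambda>x. g x - f x) < \<delta>" for g
    proof -
      obtain c where "rho (\<lambda>x. g x - f x - c) < \<epsilon>"
        using \<delta>(2) g dom_diff[OF g(1) f(1)] by (auto simp: near_def)
      then have "rho (\<lambda>x. (g x - c) - f x) < \<epsilon>" by (simp add: algebra_simps)
      moreover have "(\<lambda>x. g x - c) \<in> L0 M" using dom_L0[OF dom_shift[OF g(1)]] .
      ultimately have "cls M (\<lambda>x. g x - c) \<in> U" using \<epsilon>(2)[rule_format, of "\<lambda>x. g x - c"] by simp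
      then show ?thesis by (simp add: cls_shift)
    qed
    with \<delta>(1) show "\<exists>r>0. \<forall>g\<in>D. N (\<lambda>x. g x - f x) < r \<longrightarrow> cls M g \<in> {C \<in> cls M ` D. C \<in> U}"
      by blast
  qed auto
  have "openin (L0_quot_topology M) (cls M ` L0 M)"
    unfolding openin_L0_quot_iff openin_lcm_iff by (auto intro!: exI[of _ 1])
  then have "cls M ` L0 M \<subseteq> topspace (L0_quot_topology M)" by (rule openin_subset)
  then have "cls M ` D \<subseteq> topspace (L0_quot_topology M)" using dom_L0 by auto
  with op show "continuous_map (Me_quot_topology M E) (L0_quot_topology M) (\<lambda>C. C)"
    unfolding continuous_map_def topspace_Me_quot by auto
qed

section \<open>Completeness\<close>

lemma embedding_bound_imp_complete:
  assumes embedding_bound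
  shows "Me_complete M E"
  unfolding Me_complete_def
proof (intro allI impI, elim conjE)
  fix F :: "nat \<Rightarrow> 'a \<Rightarrow> real" assume F: "\<forall>n. F n \<in> D"
    and cauchy: "\<forall>e>0. \<exists>K. \<forall>m\<ge>K. \<forall>n\<ge>K. N (\<lambda>x. F m x - F n x) < e"
  have "\<forall>k. \<exists>\<delta>>0. \<forall>f\<in>D. N f < \<delta> \<longrightarrow> near ((1/2) ^ k) f"
    using assms by (simp add: embedding_bound_def)
  then obtain \<delta> where \<delta>: "\<And>k. \<delta> k > 0" "\<And>k f. f \<in> D \<Longrightarrow> N f < \<delta> k \<Longrightarrow> near ((1/2) ^ k) f"
    by metis
  have "\<forall>k. \<exists>K. \<forall>m\<ge>K. \<forall>n\<ge>K. N (\<lambda>x. F m x - F n x) < \<delta> k"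
    using cauchy \<delta>(1) by blast
  then obtain K where K: "\<And>k m n. m \<ge> K k \<Longrightarrow> n \<ge> K k \<Longrightarrow> N (\<lambda>x. F m x - F n x) < \<delta> k"
    by metis
  \<comment> \<open>The sum dominates \<open>K k\<close> at both \<open>k\<close> and
    \<open>Suc k\<close>, so consecutive terms of the subsequence are within
    \<open>\<delta> k\<close>; the summand \<open>k\<close> makes \<open>s k\<close> tend to
    infinity.\<close>
  define s where "s k = (\<Sum>i\<le>k. K i) + k" for k
  have s: "s k \<ge> K k" "s (Suc k) \<ge> K k" "s k \<ge> k" for k
  proof -
    show "s k \<ge> K k" unfolding s_def using member_le_sum[of k "{..k}" K] by auto
    then show "s (Suc k) \<ge> K k" by (auto simp: s_def)
    show "s k \<ge> k" by (simp add: s_def)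
  qed
  have "near ((1/2) ^ k) (\<lambda>x. F (s (Suc k)) x - F (s k) x)" for k
    using F s K by (intro \<delta>(2) dom_diff) auto
  then obtain d where d: "\<And>k. rho (\<lambda>x. F (s (Suc k)) x - F (s k) x - d k) < (1/2) ^ k"
    unfolding near_def by metis
  \<comment> \<open>Subtracting the accumulated constants makes the \<open>rho\<close>-increments
    summable, while seminorms of differences are unaffected since constants have seminorm 0.\<close>
  define G where "G k x = F (s k) x - (\<Sum>j<k. d j)" for k x
  have GD: "G k \<in> D" for k using F dom_shift by (simp add: G_def[abs_def])
  have inc: "rho (\<lambda>x. G (Suc k) x - G k x) < (1/2) ^ k" for k
    using d[of k] by (simp add: G_def algebra_simps)
  have "summable (\<lambda>k. rho (\<lambda>x. G (Suc k) x - G k x))"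
    by (rule summable_comparison_test'[of "\<lambda>k. (1/2::real) ^ k" 0])
       (use inc in \<open>auto simp: rho_nonneg less_imp_le\<close>)
  then obtain h where h: "h \<in> L0 M" and lim: "(\<lambda>k. rho (\<lambda>x. G k x - h x)) \<longlonglongrightarrow> 0"
    using rho_complete[of G] GD dom_L0 by blast
  \<comment> \<open>For fixed large \<open>n\<close>, \<open>h - F n\<close> is the
    \<open>rho\<close>-limit of \<open>G k - F n\<close>, which differs from
    \<open>F (s k) - F n\<close> by a constant and so has seminorm below \<open>l\<close> for large
    \<open>k\<close>; lower semicontinuity carries this over.\<close>
  have key: "\<exists>K. \<forall>n\<ge>K. (\<lambda>x. h x - F n x) \<in> D \<and> N (\<lambda>x. h x - F n x) \<le> l" if l: "l > 0" for l
  proof -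
    from cauchy l obtain K where K: "\<And>m n. m \<ge> K \<Longrightarrow> n \<ge> K \<Longrightarrow> N (\<lambda>x. F m x - F n x) < l" by blast
    have "(\<lambda>x. h x - F n x) \<in> D \<and> N (\<lambda>x. h x - F n x) \<le> l" if n: "n \<ge> K" for n
    proof -
      have L: "(\<lambda>x. h x - F n x) \<in> L0 M" using h dom_L0 F by (auto simp: L0_def)
      have ap: "\<exists>g\<in>D. rho (\<lambda>x. g x - (h x - F n x)) < \<epsilon> \<and> N g < l" if \<epsilon>: "\<epsilon> > 0" for \<epsilon>
      proof -
        have "eventually (\<lambda>k. rho (\<lambda>x. G k x - h x) < \<epsilon>) sequentially"
          using lim \<epsilon> by (rule order_tendstoD)
        then obtain k0 where "\<And>k. k \<ge> k0 \<Longrightarrow> rho (\<lambda>x. G k x - h x) < \<epsilon>"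
          by (auto simp: eventually_sequentially)
        then obtain k where k: "k \<ge> K" "rho (\<lambda>x. G k x - h x) < \<epsilon>"
          by (meson max.cobounded1 max.cobounded2)
        have "N (\<lambda>x. (F (s k) x - F n x) - (\<Sum>j<k. d j)) \<le> N (\<lambda>x. F (s k) x - F n x)"
          using F by (intro N_shift_le dom_diff) auto
        also have "\<dots> < l" using s(3)[of k] k(1) n by (intro K) auto
        finally have "N (\<lambda>x. G k x - F n x) < l" by (simp add: G_def algebra_simps)
        then show ?thesis using k(2) dom_diff[OF GD[of k], of "F n"] F
          by (intro bexI[of _ "\<lambda>x. G k x - F n x"]) auto
      qed
      show ?thesis using dom_closed[OF L l ap] N_lsc[OF L l ap] by blast
    qed
    then show ?thesis by blast
  qed
  from key[of 1] obtain n where "(\<lambda>x. h x - F n x) \<in> D" by auto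
  from dom_add[OF this, of "F n"] F have hD: "h \<in> D" by simp
  have "(\<lambda>n. N (\<lambda>x. F n x - h x)) \<longlonglongrightarrow> 0"
  proof (rule LIMSEQ_I)
    fix e :: real assume "e > 0"
    then obtain K where K: "\<And>n. n \<ge> K \<Longrightarrow> N (\<lambda>x. h x - F n x) \<le> e/2"
      using key[of "e/2"] by auto
    have "norm (N (\<lambda>x. F n x - h x) - 0) < e" if "n \<ge> K" for n
      using K[OF that] N_minus_commute[of "F n" h] N_nonneg[of "\<lambda>x. F n x - h x"] dom_diff[of "F n" h] F hD \<open>e > 0\<close>
      by auto
    then show "\<exists>K. \<forall>n\<ge>K. norm (N (\<lambda>x. F n x - h x) - 0) < e" by blast
  qed
  with hD show "\<exists>f\<in>D. (\<lambda>n. N (\<lambda>x. F n x - f x)) \<longlonglongrightarrow> 0" by blast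
qed

text \<open>Baire's theorem by nested balls: since \<open>f / k\<close> tends to \<open>0\<close> in measure, the sets of those \<open>f\<close> for
  which \<open>f / k\<close> is near a constant cover the whole space.\<close>

lemma complete_imp_near_dense_in_ball:
  assumes complete: "Me_complete M E" and e: "e > 0"
  shows "\<exists>k>0. \<exists>x0\<in>D. \<exists>r>0. \<forall>y\<in>D. N (\<lambda>x. y x - x0 x) < r \<longrightarrow>
    (\<forall>\<eta>>0. \<exists>g\<in>D. near e (\<lambda>x. g x / real k) \<and> N (\<lambda>x. y x - g x) < \<eta>)"
proof (rule ccontr)
  assume no: "\<not> ?thesis"
  \<comment> \<open>The negated claim says that each set \<open>{g. near e (g / k)}\<close> is
    nowhere dense: every ball contains a point at positive distance from it.\<close>
  have step: "\<exists>y\<in>D. N (\<lambda>z. y z - x z) < r \<and>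
      (\<exists>\<eta>>0. \<forall>g\<in>D. near e (\<lambda>z. g z / real k) \<longrightarrow> \<eta> \<le> N (\<lambda>z. y z - g z))"
    if "k > 0" "x \<in> D" "r > 0" for k x r
  proof -
    have "\<not> (\<forall>y\<in>D. N (\<lambda>z. y z - x z) < r \<longrightarrow>
        (\<forall>\<eta>>0. \<exists>g\<in>D. near e (\<lambda>z. g z / real k) \<and> N (\<lambda>z. y z - g z) < \<eta>))"
      using no that by blast
    then obtain y \<eta> where y: "y \<in> D" "N (\<lambda>z. y z - x z) < r" "\<eta> > 0"
      and far: "\<not> (\<exists>g\<in>D. near e (\<lambda>z. g z / real k) \<and> N (\<lambda>z. y z - g z) < \<eta>)" by blast
    have "\<forall>g\<in>D. near e (\<lambda>z. g z / real k) \<longrightarrow> \<eta> \<le> N (\<lambda>z. y z - g z)"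
      using far unfolding not_less[symmetric] by blast
    with y show ?thesis by blast
  qed
  \<comment> \<open>The pairs are centres and radii of nested balls; the ball of index
    \<open>Suc n\<close> misses the set of index \<open>Suc n\<close>.\<close>
  have "\<exists>f. \<forall>n. (fst (f n) \<in> D \<and> 0 < snd (f n) \<and> snd (f n) \<le> (1/2::real) ^ n) \<and>
     (N (\<lambda>z. fst (f (Suc n)) z - fst (f n) z) + snd (f (Suc n)) \<le> snd (f n) \<and>
       (\<forall>g\<in>D. near e (\<lambda>z. g z / real (Suc n)) \<longrightarrow> snd (f (Suc n)) < N (\<lambda>z. fst (f (Suc n)) z - g z)))"
  proof (rule dependent_nat_choice)
    show "\<exists>p. fst p \<in> D \<and> 0 < snd p \<and> snd p \<le> (1/2::real) ^ 0"
      using zero_dom by (intro exI[of _ "(\<lambda>x. 0, 1)"]) auto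
    fix p :: "('a \<Rightarrow> real) \<times> real" and n assume p: "fst p \<in> D \<and> 0 < snd p \<and> snd p \<le> (1/2) ^ n"
    then obtain y \<eta> where y: "y \<in> D" "N (\<lambda>z. y z - fst p z) < snd p" and \<eta>: "\<eta> > 0"
      "\<And>g. g \<in> D \<Longrightarrow> near e (\<lambda>z. g z / real (Suc n)) \<Longrightarrow> \<eta> \<le> N (\<lambda>z. y z - g z)"
      using step[of "Suc n" "fst p" "snd p"] by auto
    \<comment> \<open>The three bounds keep the new ball inside the old one, keep it strictly away
      from the set to be avoided, and make the radii tend to 0.\<close>
    define r where "r = min (min (snd p - N (\<lambda>z. y z - fst p z)) (\<eta>/2)) ((1/2) ^ Suc n)"
    have r1: "r \<le> (1/2) ^ Suc n" unfolding r_def by (rule min.cobounded2)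
    have r: "r > 0" "r < \<eta>" "N (\<lambda>z. y z - fst p z) + r \<le> snd p"
      using y \<eta>(1) by (auto simp: r_def)
    show "\<exists>q. (fst q \<in> D \<and> 0 < snd q \<and> snd q \<le> (1/2) ^ Suc n) \<and>
        N (\<lambda>z. fst q z - fst p z) + snd q \<le> snd p \<and>
        (\<forall>g\<in>D. near e (\<lambda>z. g z / real (Suc n)) \<longrightarrow> snd q < N (\<lambda>z. fst q z - g z))"
      using y r r1 less_le_trans[OF r(2) \<eta>(2)] by (intro exI[of _ "(y, r)"]) auto
  qed
  then obtain f where f: "\<forall>n. (fst (f n) \<in> D \<and> 0 < snd (f n) \<and> snd (f n) \<le> (1/2::real) ^ n) \<and>
     (N (\<lambda>z. fst (f (Suc n)) z - fst (f n) z) + snd (f (Suc n)) \<le> snd (f n) \<and>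
       (\<forall>g\<in>D. near e (\<lambda>z. g z / real (Suc n)) \<longrightarrow> snd (f (Suc n)) < N (\<lambda>z. fst (f (Suc n)) z - g z)))"
    by (rule exE)
  define X where "X n = fst (f n)" for n
  define r where "r n = snd (f n)" for n
  note f' = f[folded X_def r_def, THEN spec]
  have X: "X n \<in> D" and r: "0 < r n" "r n \<le> (1/2) ^ n"
    and Xr: "N (\<lambda>z. X (Suc n) z - X n z) + r (Suc n) \<le> r n" for n
    using f'[of n] by simp_all
  have avoid: "r (Suc n) < N (\<lambda>z. X (Suc n) z - g z)" if "g \<in> D" "near e (\<lambda>z. g z / real (Suc n))" for n g
    using f'[of n, THEN conjunct2, THEN conjunct2, THEN bspec, OF that(1)] that(2) by (rule mp)
  have nested: "N (\<lambda>z. X m z - X n z) + r m \<le> r n" if "n \<le> m" for m n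
    using that
  proof (induction m rule: dec_induct)
    case base
    then show ?case by (simp add: N_zero)
  next
    case (step m)
    then show ?case using N_triangle[OF X[of "Suc m"] X[of m] X[of n]] Xr[of m] by linarith
  qed
  have "\<exists>K. \<forall>m\<ge>K. \<forall>n\<ge>K. N (\<lambda>x. X m x - X n x) < \<epsilon>" if \<epsilon>: "\<epsilon> > 0" for \<epsilon>
  proof -
    obtain K where K: "(1/2::real) ^ K < \<epsilon>/2"
      using real_arch_pow_inv[of "\<epsilon>/2" "1/2"] \<epsilon> by auto
    have "N (\<lambda>x. X m x - X n x) < \<epsilon>" if "m \<ge> K" "n \<ge> K" for m n
      using N_triangle[OF X[of m] X[of K] X[of n]] N_minus_commute[OF X[of K] X[of n]]
        nested[OF that(1)] nested[OF that(2)] r(1)[of m] r(1)[of n] r(2)[of K] K by linarith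
    then show ?thesis by blast
  qed
  then obtain z where z: "z \<in> D" and lim: "(\<lambda>n. N (\<lambda>x. X n x - z x)) \<longlonglongrightarrow> 0"
    using complete X unfolding Me_complete_def by blast
  \<comment> \<open>The limit lies in every closed ball, because all later centres do.\<close>
  have close: "N (\<lambda>x. X n x - z x) \<le> r n" for n
  proof (rule field_le_epsilon)
    fix \<epsilon> :: real assume "\<epsilon> > 0"
    then have "eventually (\<lambda>m. N (\<lambda>x. X m x - z x) < \<epsilon>) sequentially"
      using lim by (intro order_tendstoD)
    then obtain m where m: "m \<ge> n" "N (\<lambda>x. X m x - z x) < \<epsilon>"
      unfolding eventually_sequentially by (meson max.cobounded1 max.cobounded2)
    then show "N (\<lambda>x. X n x - z x) \<le> r n + \<epsilon>"
      using N_triangle[OF X[of n] X[of m] z] nested[OF m(1)] N_minus_commute[OF X[of n] X[of m]] r(1)[of m]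
      by linarith
  qed
  \<comment> \<open>The contradiction: \<open>z / (n+1)\<close> tends to 0 almost everywhere, so
    \<open>z\<close> belongs to one of the sets, although it lies in the ball that avoids this
    set.\<close>
  have "(\<lambda>n. rho (\<lambda>x. z x / real (Suc n))) \<longlonglongrightarrow> 0"
  proof (rule rho_tendsto_0)
    show "AE x in M. (\<lambda>n. z x / real (Suc n)) \<longlonglongrightarrow> 0"
    proof (rule AE_I2)
      fix x
      have "(\<lambda>n. z x * inverse (real (Suc n))) \<longlonglongrightarrow> z x * 0"
        by (intro tendsto_intros LIMSEQ_inverse_real_of_nat)
      then show "(\<lambda>n. z x / real (Suc n)) \<longlonglongrightarrow> 0" by (simp add: divide_inverse)
    qed
  qed (rule L0_divide[OF dom_L0[OF z]])
  then have "eventually (\<lambda>n. rho (\<lambda>x. z x / real (Suc n)) < e) sequentially"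
    using e by (rule order_tendstoD)
  then obtain n where "rho (\<lambda>x. z x / real (Suc n)) < e"
    by (auto simp: eventually_sequentially)
  then have "near e (\<lambda>x. z x / real (Suc n))" by (auto simp: near_def intro!: exI[of _ 0])
  from avoid[OF z this] close[of "Suc n"] show False by simp
qed

lemma near_diff:
  assumes "f \<in> L0 M" "g \<in> L0 M" "near a f" "near b g"
  shows "near (a + b) (\<lambda>x. f x - g x)"
proof -
  obtain c d where cd: "rho (\<lambda>x. f x - c) < a" "rho (\<lambda>x. g x - d) < b"
    using assms by (auto simp: near_def)
  have "rho (\<lambda>x. (f x - c) + - (g x - d)) \<le> rho (\<lambda>x. f x - c) + rho (\<lambda>x. - (g x - d))"
    using assms by (intro rho_add_le) (auto simp: L0_def)
  also have "\<dots> < a + b" using cd unfolding rho_minus by simp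
  finally have "rho (\<lambda>x. (f x - g x) - (c - d)) < a + b" by (simp add: algebra_simps)
  then show ?thesis by (auto simp: near_def)
qed

text \<open>Density near \<open>x0\<close> is moved to the origin: \<open>x0 + k f\<close> and
  \<open>x0\<close> are both approximated by elements of the k-th set, and the difference of the
  approximants, divided by \<open>k\<close>, approximates \<open>f\<close>. The two tolerances
  \<open>e/2\<close> add up to \<open>e\<close>.\<close>

lemma complete_imp_almost_open:
  assumes complete: "Me_complete M E" and e: "e > 0"
  shows "\<exists>\<delta>>0. \<forall>f\<in>D. N f < \<delta> \<longrightarrow> (\<forall>\<eta>>0. \<exists>g\<in>D. near e g \<and> N (\<lambda>x. f x - g x) < \<eta>)"
proof -
  obtain k x0 r where k: "k > 0" and x0: "x0 \<in> D" and r: "r > 0"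
    and dense': "\<forall>y\<in>D. N (\<lambda>x. y x - x0 x) < r \<longrightarrow>
      (\<forall>\<eta>>0. \<exists>g\<in>D. near (e/2) (\<lambda>x. g x / real k) \<and> N (\<lambda>x. y x - g x) < \<eta>)"
    using complete_imp_near_dense_in_ball[OF complete half_gt_zero[OF e]] by blast
  note dense = dense'[rule_format]
  show ?thesis
  proof (intro exI[of _ "r / real k"] conjI ballI allI impI)
    show "r / real k > 0" using r k by simp
    fix f \<eta> assume f: "f \<in> D" "N f < r / real k" and \<eta>: "(\<eta>::real) > 0"
    define y where "y x = x0 x + real k * f x" for x
    have kf: "(\<lambda>x. real k * f x) \<in> D" using k by (intro dom_scale f) auto
    have y: "y \<in> D" using dom_add[OF x0 kf] by (simp add: y_def[abs_def])
    have "N (\<lambda>x. real k * f x) \<le> real k * N f" using k by (intro N_scale f) auto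
    also have "\<dots> < r" using f(2) k by (simp add: field_simps)
    finally have yr: "N (\<lambda>x. y x - x0 x) < r" by (simp add: y_def)
    have \<eta>': "real k * \<eta> / 2 > 0" using \<eta> k by simp
    from dense[OF y yr \<eta>'] obtain g where g: "g \<in> D" "near (e/2) (\<lambda>x. g x / real k)"
      "N (\<lambda>x. y x - g x) < real k * \<eta> / 2" by blast
    have "N (\<lambda>x. x0 x - x0 x) < r" using r by (simp add: N_zero)
    from dense[OF x0 this \<eta>'] obtain h where h: "h \<in> D" "near (e/2) (\<lambda>x. h x / real k)"
      "N (\<lambda>x. x0 x - h x) < real k * \<eta> / 2" by blast
    define u where "u x = g x / real k - h x / real k" for x
    have "(\<lambda>x. 1 / real k * (g x - h x)) \<in> D" using k by (intro dom_scale dom_diff g h) auto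
    then have u: "u \<in> D" by (simp add: u_def[abs_def] diff_divide_distrib)
    have nu: "near e u"
      using near_diff[OF L0_divide[OF dom_L0[OF g(1)]] L0_divide[OF dom_L0[OF h(1)]] g(2) h(2)]
      by (simp add: u_def[abs_def])
    have yg: "(\<lambda>x. y x - g x) \<in> D" and xh: "(\<lambda>x. x0 x - h x) \<in> D"
      using y g x0 h dom_diff by auto
    have "N (\<lambda>x. 1 / real k * ((y x - g x) - (x0 x - h x))) \<le> 1 / real k * N (\<lambda>x. (y x - g x) - (x0 x - h x))"
      using k by (intro N_scale dom_diff[OF yg xh]) auto
    also have "\<dots> \<le> 1 / real k * (N (\<lambda>x. y x - g x) + N (\<lambda>x. x0 x - h x))"
      by (intro mult_left_mono N_diff[OF yg xh]) auto
    also have "\<dots> < 1 / real k * (real k * \<eta>)"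
      using g(3) h(3) k by (intro mult_strict_left_mono) auto
    also have "\<dots> = \<eta>" using k by simp
    also have "(\<lambda>x. 1 / real k * ((y x - g x) - (x0 x - h x))) = (\<lambda>x. f x - u x)"
      using k by (auto simp: y_def u_def field_simps)
    finally show "\<exists>g\<in>D. near e g \<and> N (\<lambda>x. f x - g x) < \<eta>" using u nu by blast
  qed
qed

text \<open>Successive approximation as in the open mapping theorem: each remainder is reduced by a
  function close to a constant, the reductions without these constants sum up in \<open>rho\<close>
  to \<open>h\<close>, and the remainders vanish in seminorm. Hence \<open>f - h\<close> has
  seminorm 0 and is constant by the kernel assumption.\<close>

lemma complete_imp_embedding_bound:
  assumes complete: "Me_complete M E"
  shows embedding_bound
  unfolding embedding_bound_def
proof (intro allI impI)
  fix e :: real assume e: "e > 0"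
  \<comment> \<open>These tolerances sum to \<open>e/2\<close>, which leaves room for the strict
    inequality in \<open>near e f\<close>.\<close>
  define a where "a n = e/2 * (1/2) ^ Suc n" for n :: nat
  have a: "a n > 0" for n using e by (simp add: a_def)
  have "\<forall>n. \<exists>\<delta>>0. \<forall>f\<in>D. N f < \<delta> \<longrightarrow> (\<forall>\<eta>>0. \<exists>g\<in>D. near (a n) g \<and> N (\<lambda>x. f x - g x) < \<eta>)"
    using complete_imp_almost_open[OF complete a] ..
  then obtain \<delta> where \<delta>': "\<forall>n. \<delta> n > 0 \<and> (\<forall>f\<in>D. N f < \<delta> n \<longrightarrow>
      (\<forall>\<eta>>0. \<exists>g\<in>D. near (a n) g \<and> N (\<lambda>x. f x - g x) < \<eta>))"
    unfolding choice_iff by blast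
  have \<delta>: "\<delta> n > 0" for n using \<delta>' by blast
  have approx: "\<exists>g\<in>D. near (a n) g \<and> N (\<lambda>x. f x - g x) < \<eta>"
    if "f \<in> D" "N f < \<delta> n" "\<eta> > 0" for n f \<eta>
    using \<delta>' that by blast
  \<comment> \<open>The first bound makes the next approximation available, the second drives the
    remainders to 0 in seminorm.\<close>
  define d where "d n = min (\<delta> n) ((1/2) ^ n)" for n
  have d: "d n > 0" for n using \<delta> by (simp add: d_def)
  have "near e f" if f: "f \<in> D" "N f < d 0" for f
  proof -
    \<comment> \<open>\<open>R n\<close> is the remainder after \<open>n\<close> reductions; the
      clause for \<open>n = 0\<close> pins the start of the recursion to \<open>f\<close>.\<close>
    have "\<exists>R. \<forall>n. (R n \<in> D \<and> N (R n) < d n \<and> (n = 0 \<longrightarrow> R n = f)) \<and>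
        near (a n) (\<lambda>x. R n x - R (Suc n) x)"
    proof (rule dependent_nat_choice)
      show "\<exists>R. R \<in> D \<and> N R < d 0 \<and> ((0::nat) = 0 \<longrightarrow> R = f)" using f by auto
      fix R and n :: nat assume "R \<in> D \<and> N R < d n \<and> (n = 0 \<longrightarrow> R = f)"
      then have R: "R \<in> D" "N R < \<delta> n" by (auto simp: d_def)
      from approx[OF R d[of "Suc n"]] obtain g where g: "g \<in> D" "near (a n) g" "N (\<lambda>x. R x - g x) < d (Suc n)"
        by blast
      then show "\<exists>S. (S \<in> D \<and> N S < d (Suc n) \<and> (Suc n = 0 \<longrightarrow> S = f)) \<and> near (a n) (\<lambda>x. R x - S x)"
        using dom_diff[OF R(1) g(1)] by (intro exI[of _ "\<lambda>x. R x - g x"]) auto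
    qed
    then obtain R where R: "\<And>n. R n \<in> D" "\<And>n. N (R n) < d n" "R 0 = f"
      and nR: "\<And>n. near (a n) (\<lambda>x. R n x - R (Suc n) x)" by blast
    obtain c where c: "\<And>n. rho (\<lambda>x. R n x - R (Suc n) x - c n) < a n"
      using nR unfolding near_def by metis
    \<comment> \<open>\<open>f - R n\<close> is the sum of the first \<open>n\<close> reductions;
      from each of them its nearby constant is subtracted.\<close>
    define G where "G n x = f x - R n x - (\<Sum>k<n. c k)" for n x
    have GD: "G n \<in> D" for n unfolding G_def[abs_def] by (intro dom_shift dom_diff f R)
    have inc: "rho (\<lambda>x. G (Suc n) x - G n x) < a n" for n
      using c[of n] by (simp add: G_def algebra_simps)
    have "summable (\<lambda>n. rho (\<lambda>x. G (Suc n) x - G n x))"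
    proof (rule summable_comparison_test'[of a 0])
      show "summable a" unfolding a_def[abs_def] by (intro summable_mult summable_ignore_initial_segment[of _ 1, simplified]) auto
    qed (use inc in \<open>auto simp: rho_nonneg less_imp_le\<close>)
    then obtain h where h: "h \<in> L0 M" and lim: "(\<lambda>n. rho (\<lambda>x. G n x - h x)) \<longlonglongrightarrow> 0"
      using rho_complete[of G] GD dom_L0 by blast
    have ev: "eventually (\<lambda>n. rho (\<lambda>x. G n x - h x) < \<epsilon>) sequentially" if "\<epsilon> > 0" for \<epsilon>
      using lim that by (rule order_tendstoD)
    have Gle: "rho (G n) \<le> e/2 * (1 - (1/2) ^ n)" for n
    proof (induction n)
      case 0
      then show ?case by (simp add: G_def[abs_def] R)
    next
      case (Suc n)
      have "rho (\<lambda>x. (G (Suc n) x - G n x) + G n x) \<le> rho (\<lambda>x. G (Suc n) x - G n x) + rho (G n)"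
        using dom_L0[OF GD] by (intro rho_add_le) (auto simp: L0_def)
      then have "rho (G (Suc n)) \<le> a n + e/2 * (1 - (1/2) ^ n)" using inc[of n] Suc by simp
      then show ?case by (simp add: a_def field_simps)
    qed
    have "rho h \<le> e/2"
    proof (rule field_le_epsilon)
      fix \<epsilon> :: real assume "\<epsilon> > 0"
      then obtain n where n: "rho (\<lambda>x. G n x - h x) < \<epsilon>" using ev by (auto simp: eventually_sequentially)
      have "rho (\<lambda>x. G n x + - (G n x - h x)) \<le> rho (G n) + rho (\<lambda>x. - (G n x - h x))"
        using dom_L0[OF GD] h by (intro rho_add_le) (auto simp: L0_def)
      moreover have "e/2 * (1 - (1/2) ^ n) \<le> e/2 * 1" using e by (intro mult_left_mono) auto
      ultimately show "rho h \<le> e/2 + \<epsilon>" using n Gle[of n] unfolding rho_minus by simp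
    qed
    have L: "(\<lambda>x. f x - h x) \<in> L0 M" using dom_L0[OF f(1)] h by (simp add: L0_def)
    \<comment> \<open>\<open>f - G n\<close> tends to \<open>f - h\<close> in \<open>rho\<close> and
      differs from \<open>R n\<close> by a constant, so lower semicontinuity bounds the seminorm of
      \<open>f - h\<close> by every positive \<open>l\<close>.\<close>
    have ap: "\<exists>g\<in>D. rho (\<lambda>x. g x - (f x - h x)) < \<epsilon> \<and> N g < l" if \<epsilon>: "\<epsilon> > 0" and l: "l > 0" for \<epsilon> l
    proof -
      have "eventually (\<lambda>n. (1/2::real) ^ n < l) sequentially"
        using l by (intro order_tendstoD[OF LIMSEQ_power_zero]) auto
      with ev[OF \<epsilon>] have "eventually (\<lambda>n. rho (\<lambda>x. G n x - h x) < \<epsilon> \<and> (1/2::real) ^ n < l) sequentially"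
        by eventually_elim simp
      then obtain n where n: "rho (\<lambda>x. G n x - h x) < \<epsilon>" "(1/2::real) ^ n < l"
        by (auto simp: eventually_sequentially)
      have fG: "(\<lambda>x. f x - G n x) = (\<lambda>x. R n x - (- (\<Sum>k<n. c k)))" by (auto simp: G_def)
      have "N (\<lambda>x. f x - G n x) \<le> N (R n)" unfolding fG by (intro N_shift_le R)
      also have "\<dots> < l" using R(2)[of n] n(2) by (simp add: d_def)
      finally have "N (\<lambda>x. f x - G n x) < l" .
      moreover have "rho (\<lambda>x. (f x - G n x) - (f x - h x)) < \<epsilon>"
        using n(1) rho_minus_commute[of h "G n"] by simp
      ultimately show ?thesis using dom_diff[OF f(1) GD[of n]]
        by (intro bexI[of _ "\<lambda>x. f x - G n x"] conjI)
    qed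
    have fh: "(\<lambda>x. f x - h x) \<in> D" by (rule dom_closed[OF L zero_less_one]) (rule ap[OF _ zero_less_one])
    have "N (\<lambda>x. f x - h x) \<le> l" if "l > 0" for l by (rule N_lsc[OF L that]) (rule ap[OF _ that])
    then have "N (\<lambda>x. f x - h x) \<le> 0" by (rule dense_ge)
    then have "N (\<lambda>x. f x - h x) = 0" using N_nonneg[OF fh] by simp
    with fh have "(\<lambda>x. f x - h x) \<in> {f \<in> D. N f = 0}" by simp
    then obtain b where b: "AE x in M. f x - h x = b" unfolding ker by auto
    have "rho (\<lambda>x. f x - b) = rho h"
      by (rule rho_cong) (use b dom_L0[OF f(1)] h in \<open>auto simp: L0_def elim!: AE_mp\<close>)
    with \<open>rho h \<le> e/2\<close> e show "near e f" by (auto simp: near_def intro!: exI[of _ b])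
  qed
  with d show "\<exists>\<delta>>0. \<forall>f\<in>D. N f < \<delta> \<longrightarrow> near e f" by blast
qed

end

section \<open>The weak Poincare inequality\<close>

lemma AE_null_space: "emeasure M (space M) = 0 \<Longrightarrow> AE x in M. P x"
  by (metis ae_filter_eq_bot_iff eventually_bot)

text \<open>A nonnull space excludes the value \<open>-\<infinity>\<close>, by comparison with the
  essential supremum of the constant \<open>- C\<close>.\<close>

lemma esssup_real_bounded:
  fixes f :: "'a \<Rightarrow> real"
  assumes [measurable]: "f \<in> borel_measurable M" and b: "AE x in M. \<bar>f x\<bar> \<le> C"
    and nn: "emeasure M (space M) \<noteq> 0"
  obtains b where "esssup M (\<lambda>x. ereal (f x)) = ereal b" "b \<le> C"
proof -
  have up: "esssup M (\<lambda>x. ereal (f x)) \<le> ereal C"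
    using b by (intro esssup_I) (auto elim!: AE_mp)
  have "esssup M (\<lambda>x. ereal (- C)) \<le> esssup M (\<lambda>x. ereal (f x))"
    using b by (intro esssup_AE_mono) (auto elim!: AE_mp)
  then have "ereal (- C) \<le> esssup M (\<lambda>x. ereal (f x))" using nn by (simp add: esssup_const)
  with up that show thesis by (cases "esssup M (\<lambda>x. ereal (f x))") auto
qed

lemma osc_bounds:
  assumes "f \<in> Linf M"
  obtains a where "AE x in M. a \<le> f x \<and> f x \<le> a + osc M f" "0 \<le> osc M f"
proof (cases "emeasure M (space M) = 0")
  case True
  have "f \<in> borel_measurable M" using assms by (simp add: Linf_def)
  \<comment> \<open>On a null space both essential suprema are \<open>-\<infinity>\<close>, and
    \<open>real_of_ereal\<close> sends the resulting infinite difference to 0.\<close>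
  then have "osc M f = 0" using True by (simp add: osc_def esssup_zero_space)
  with that[OF AE_null_space[OF True]] show thesis by simp
next
  case False
  from assms obtain C where [measurable]: "f \<in> borel_measurable M" and C: "AE x in M. \<bar>f x\<bar> \<le> C"
    by (auto simp: Linf_def)
  obtain b where b: "esssup M (\<lambda>x. ereal (f x)) = ereal b"
    using esssup_real_bounded[OF _ C False] by auto
  have C': "AE x in M. \<bar>- f x\<bar> \<le> C" using C by simp
  obtain a where a: "esssup M (\<lambda>x. ereal (- f x)) = ereal a"
    using esssup_real_bounded[OF _ C' False] by auto
  have osc: "osc M f = b + a" by (simp add: osc_def a b)
  have bd: "AE x in M. - a \<le> f x \<and> f x \<le> b"
    using esssup_AE[of "\<lambda>x. ereal (f x)" M] esssup_AE[of "\<lambda>x. ereal (- f x)" M]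
    by eventually_elim (simp add: a b)
  then have "AE x in M. - a \<le> b" by eventually_elim simp
  then have "- a \<le> b" using False by (simp add: eventually_const ae_filter_eq_bot_iff)
  with bd that[of "- a"] show thesis by (simp add: osc)
qed

lemma osc_le_2:
  assumes [measurable]: "f \<in> borel_measurable M" and b: "AE x in M. \<bar>f x\<bar> \<le> 1"
  shows "osc M f \<le> 2"
proof (cases "emeasure M (space M) = 0")
  case True
  then show ?thesis by (simp add: osc_def esssup_zero_space)
next
  case False
  obtain u where u: "esssup M (\<lambda>x. ereal (f x)) = ereal u" "u \<le> 1"
    using esssup_real_bounded[OF _ b False] by auto
  have b': "AE x in M. \<bar>- f x\<bar> \<le> 1" using b by simp
  obtain v where v: "esssup M (\<lambda>x. ereal (- f x)) = ereal v" "v \<le> 1"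
    using esssup_real_bounded[OF _ b' False] by auto
  show ?thesis using u v by (simp add: osc_def)
qed

lemma powr_le_self:
  fixes t p :: real
  assumes "0 \<le> t" "t \<le> 1" "1 \<le> p"
  shows "t powr p \<le> t"
  using powr_mono'[of 1 p t] assms by simp

text \<open>A contraction whose absolute value is the cut-off in \<open>rho\<close>; this links
  truncated functions to \<open>rho\<close>.\<close>

definition unit_clamp :: "real \<Rightarrow> real" where "unit_clamp t = max (-1) (min t 1)"

lemma unit_clamp_lipschitz: "\<bar>unit_clamp s - unit_clamp t\<bar> \<le> \<bar>s - t\<bar>"
  and unit_clamp_zero: "unit_clamp 0 = 0"
  and abs_unit_clamp: "\<bar>unit_clamp t\<bar> = min \<bar>t\<bar> 1"
  by (auto simp: unit_clamp_def)

lemma unit_clamp_measurable [measurable]: "unit_clamp \<in> borel_measurable borel"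
  by (rule lipschitz_measurable[OF unit_clamp_lipschitz])

section \<open>Weighted means and deviations from the mean\<close>

context weighted_measure
begin

abbreviation W :: real where "W \<equiv> integral\<^sup>L M w"

lemma W_pos:
  assumes "emeasure M (space M) \<noteq> 0"
  shows "W > 0"
proof -
  have nn: "AE x in M. 0 \<le> w x" using w_nonneg by (intro AE_I2)
  then have "W \<ge> 0" by (rule integral_nonneg_AE)
  moreover have "W \<noteq> 0"
  proof
    assume "W = 0"
    then have "AE x in M. w x = 0" using integral_nonneg_eq_0_iff_AE[OF w_integrable nn] by simp
    then have "AE x in M. False"
      using AE_space
    proof eventually_elim
      case (elim x)
      then show False using w_pos[of x] by simp
    qed
    then show False using assms by (simp add: eventually_const ae_filter_eq_bot_iff)
  qed
  ultimately show ?thesis by simp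
qed

lemma weighted_integrable:
  assumes "u \<in> borel_measurable M" "AE x in M. \<bar>u x\<bar> \<le> C"
  shows "integrable M (\<lambda>x. u x * w x)"
proof (rule Bochner_Integration.integrable_bound[OF integrable_mult_right[OF w_integrable, of C]])
  show "(\<lambda>x. u x * w x) \<in> borel_measurable M" using assms(1) by simp
  show "AE x in M. norm (u x * w x) \<le> norm (C * w x)"
    using assms(2)
    by eventually_elim (auto simp: abs_mult intro!: mult_right_mono)
qed

lemma weighted_integral_mono:
  assumes "integrable M (\<lambda>x. u x * w x)" "integrable M (\<lambda>x. v x * w x)" "AE x in M. u x \<le> v x"
  shows "(LINT x|M. u x * w x) \<le> (LINT x|M. v x * w x)"
proof (rule integral_mono_AE[OF assms(1,2)])
  show "AE x in M. u x * w x \<le> v x * w x"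
    using assms(3) AE_space by eventually_elim (auto intro!: mult_right_mono w_nonneg)
qed

lemma wmean_bounds:
  assumes [measurable]: "g \<in> borel_measurable M" and b: "AE x in M. b \<le> g x \<and> g x \<le> b + 1"
    and W: "W > 0"
  shows "b \<le> wmean M w g" "wmean M w g \<le> b + 1"
proof -
  have i: "integrable M (\<lambda>x. g x * w x)"
    by (rule weighted_integrable[where C = "\<bar>b\<bar> + 1"]) (use b in \<open>auto elim!: AE_mp\<close>)
  have c: "integrable M (\<lambda>x. c * w x)" for c using w_integrable by simp
  have "(LINT x|M. b * w x) \<le> (LINT x|M. g x * w x)"
    using b by (intro weighted_integral_mono i c) auto
  moreover have "(LINT x|M. g x * w x) \<le> (LINT x|M. (b + 1) * w x)"
    using b by (intro weighted_integral_mono i c) auto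
  ultimately have "b * W \<le> (LINT x|M. g x * w x)" "(LINT x|M. g x * w x) \<le> (b + 1) * W" by simp_all
  then show "b \<le> wmean M w g" "wmean M w g \<le> b + 1"
    using W by (simp_all add: wmean_def pos_le_divide_eq pos_divide_le_eq)
qed

text \<open>\<open>g\<close> and its mean lie in a common interval of length 1, so
  \<open>p\<close>-th powers of the deviation are at most the deviation itself. Passing from an
  arbitrary constant to the mean costs the factor 2.\<close>

lemma
  assumes g [measurable]: "g \<in> borel_measurable M" and b: "AE x in M. b \<le> g x \<and> g x \<le> b + 1"
    and W: "W > 0" and p: "1 \<le> p"
  shows deviation_le_mass: "(LINT x|M. \<bar>g x - wmean M w g\<bar> powr p * w x) \<le> W"
    and deviation_le_rho: "(LINT x|M. \<bar>g x - wmean M w g\<bar> powr p * w x) \<le> 2 * rho (\<lambda>x. g x - c)"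
proof -
  define m where "m = wmean M w g"
  have m: "b \<le> m" "m \<le> b + 1" unfolding m_def using wmean_bounds[OF g b W] by auto
  have dev: "AE x in M. \<bar>g x - m\<bar> \<le> 1" using b by eventually_elim (use m in auto)
  have dp: "AE x in M. \<bar>g x - m\<bar> powr p \<le> \<bar>g x - m\<bar>"
    using dev by eventually_elim (intro powr_le_self p, auto)
  have i1: "integrable M (\<lambda>x. \<bar>g x - m\<bar> * w x)"
    by (rule weighted_integrable[where C = 1]) (use dev in auto)
  have ip: "integrable M (\<lambda>x. \<bar>g x - m\<bar> powr p * w x)"
  proof (rule weighted_integrable[where C = 1])
    show "AE x in M. \<bar>\<bar>g x - m\<bar> powr p\<bar> \<le> 1" using dev dp by eventually_elim simp
  qed simp
  have le1: "(LINT x|M. \<bar>g x - m\<bar> powr p * w x) \<le> (LINT x|M. \<bar>g x - m\<bar> * w x)"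
    by (rule weighted_integral_mono[OF ip i1 dp])
  also have "\<dots> \<le> (LINT x|M. 1 * w x)"
    by (rule weighted_integral_mono[OF i1 _ dev]) (use w_integrable in simp)
  finally show "(LINT x|M. \<bar>g x - wmean M w g\<bar> powr p * w x) \<le> W" by (simp add: m_def)
  \<comment> \<open>Moving \<open>c\<close> into the essential range of \<open>g\<close> decreases the distance and makes the truncation void.\<close>
  define c' where "c' = max b (min c (b + 1))"
  have c': "b \<le> c'" "c' \<le> b + 1" by (auto simp: c'_def)
  have near: "AE x in M. \<bar>g x - c'\<bar> \<le> min \<bar>g x - c\<bar> 1"
    using b by eventually_elim (auto simp: c'_def)
  have ic: "integrable M (\<lambda>x. \<bar>g x - c'\<bar> * w x)"
    by (rule weighted_integrable[where C = 1]) (use near in \<open>auto elim!: AE_mp\<close>)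
  have ic': "integrable M (\<lambda>x. (g x - c') * w x)"
    by (rule weighted_integrable[where C = 1]) (use near in \<open>auto elim!: AE_mp\<close>)
  have le_rho: "(LINT x|M. \<bar>g x - c'\<bar> * w x) \<le> rho (\<lambda>x. g x - c)"
    unfolding rho_def by (rule weighted_integral_mono[OF ic rho_integrable near]) (simp add: L0_def)
  have ig: "integrable M (\<lambda>x. g x * w x)"
    by (rule weighted_integrable[where C = "\<bar>b\<bar> + 1"]) (use b in \<open>auto elim!: AE_mp\<close>)
  have "m * W = (LINT x|M. g x * w x)" using W by (simp add: m_def wmean_def)
  then have "(m - c') * W = (LINT x|M. (g x - c') * w x)"
    using ig w_integrable by (simp add: left_diff_distrib)
  then have "\<bar>m - c'\<bar> * W = \<bar>LINT x|M. (g x - c') * w x\<bar>"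
    using W by (metis abs_mult abs_of_pos)
  also have "\<dots> \<le> (LINT x|M. \<bar>(g x - c') * w x\<bar>)" by (rule integral_abs_bound)
  also have "\<dots> = (LINT x|M. \<bar>g x - c'\<bar> * w x)"
    using w_nonneg by (intro Bochner_Integration.integral_cong) (auto simp: abs_mult)
  finally have mc: "\<bar>m - c'\<bar> * W \<le> rho (\<lambda>x. g x - c)" using le_rho by simp
  have "(LINT x|M. \<bar>g x - m\<bar> * w x) \<le> (LINT x|M. (\<bar>g x - c'\<bar> + \<bar>m - c'\<bar>) * w x)"
    using ic w_integrable by (intro weighted_integral_mono i1) (auto simp: distrib_right)
  also have "\<dots> = (LINT x|M. \<bar>g x - c'\<bar> * w x) + \<bar>m - c'\<bar> * W"
    using ic w_integrable by (simp add: distrib_right)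
  finally show "(LINT x|M. \<bar>g x - wmean M w g\<bar> powr p * w x) \<le> 2 * rho (\<lambda>x. g x - c)"
    using le1 le_rho mc by (simp add: m_def)
qed

lemma exists_clamped_mean_zero:
  assumes [measurable]: "f \<in> borel_measurable M" and W: "W > 0"
  obtains c where "wmean M w (\<lambda>x. unit_clamp (f x - c)) = 0"
proof -
  define \<phi> where "\<phi> c = (LINT x|M. unit_clamp (f x - c) * w x)" for c
  have i: "integrable M (\<lambda>x. unit_clamp (f x - c) * w x)" for c
    by (rule weighted_integrable[where C = 1]) (auto simp: abs_unit_clamp)
  have lip: "\<bar>\<phi> c - \<phi> d\<bar> \<le> W * \<bar>c - d\<bar>" for c d
  proof -
    have "\<bar>\<phi> c - \<phi> d\<bar> = \<bar>LINT x|M. (unit_clamp (f x - c) - unit_clamp (f x - d)) * w x\<bar>"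
      using i by (simp add: \<phi>_def left_diff_distrib)
    also have "\<dots> \<le> (LINT x|M. \<bar>(unit_clamp (f x - c) - unit_clamp (f x - d)) * w x\<bar>)" by (rule integral_abs_bound)
    also have "\<dots> = (LINT x|M. \<bar>unit_clamp (f x - c) - unit_clamp (f x - d)\<bar> * w x)"
      using w_nonneg by (intro Bochner_Integration.integral_cong) (auto simp: abs_mult)
    also have "\<dots> \<le> (LINT x|M. \<bar>c - d\<bar> * w x)"
    proof (rule weighted_integral_mono)
      have le: "\<bar>unit_clamp (f x - c) - unit_clamp (f x - d)\<bar> \<le> \<bar>c - d\<bar>" for x
        using unit_clamp_lipschitz[of "f x - c" "f x - d"] by simp
      then show "AE x in M. \<bar>unit_clamp (f x - c) - unit_clamp (f x - d)\<bar> \<le> \<bar>c - d\<bar>" by simp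
      show "integrable M (\<lambda>x. \<bar>unit_clamp (f x - c) - unit_clamp (f x - d)\<bar> * w x)"
        by (rule weighted_integrable[where C = "\<bar>c - d\<bar>"]) (use le in auto)
    qed (use w_integrable in simp)
    finally show ?thesis by (simp add: mult.commute)
  qed
  have "W-lipschitz_on UNIV \<phi>"
    using lip W by (intro lipschitz_onI) (auto simp: dist_real_def)
  then have cont: "continuous_on UNIV \<phi>" by (rule lipschitz_on_continuous_on)
  \<comment> \<open>Both ends at once: moving the centre to plus or minus infinity saturates the
    truncation at -1 or 1, so the continuous function \<open>\<phi>\<close> changes sign.\<close>
  have lim: "(\<lambda>n. LINT x|M. unit_clamp (f x - \<sigma> * real n) * w x) \<longlonglongrightarrow> (LINT x|M. - \<sigma> * w x)"
    if \<sigma>: "\<sigma> = 1 \<or> \<sigma> = -1" for \<sigma> :: real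
  proof (rule integral_dominated_convergence[where w = w])
    show "AE x in M. (\<lambda>n. unit_clamp (f x - \<sigma> * real n) * w x) \<longlonglongrightarrow> - \<sigma> * w x"
    proof (rule AE_I2)
      fix x assume "x \<in> space M"
      have "eventually (\<lambda>n. \<bar>f x\<bar> + 1 \<le> real n) sequentially"
        using filterlim_real_sequentially by (auto simp: filterlim_at_top)
      then have "eventually (\<lambda>n. unit_clamp (f x - \<sigma> * real n) * w x = - \<sigma> * w x) sequentially"
        by eventually_elim (use \<sigma> in \<open>auto simp: unit_clamp_def\<close>)
      then show "(\<lambda>n. unit_clamp (f x - \<sigma> * real n) * w x) \<longlonglongrightarrow> - \<sigma> * w x" by (rule tendsto_eventually)
    qed
    show "\<And>n. AE x in M. norm (unit_clamp (f x - \<sigma> * real n) * w x) \<le> w x"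
      using w_nonneg by (intro AE_I2) (auto simp: abs_mult abs_unit_clamp intro!: mult_left_le_one_le)
  qed (use w_integrable in auto)
  have "(\<lambda>n. \<phi> (real n)) \<longlonglongrightarrow> - W" using lim[of 1] by (simp add: \<phi>_def)
  then have "eventually (\<lambda>n. \<phi> (real n) < 0) sequentially"
    by (rule order_tendstoD) (use W in simp)
  then obtain m where m: "\<phi> (real m) \<le> 0" by (auto simp: eventually_sequentially intro: less_imp_le)
  have "(\<lambda>n. \<phi> (- real n)) \<longlonglongrightarrow> W" using lim[of "-1"] by (simp add: \<phi>_def)
  then have "eventually (\<lambda>n. \<phi> (- real n) > 0) sequentially"
    by (rule order_tendstoD) (use W in simp)
  then obtain n where n: "\<phi> (- real n) \<ge> 0" by (auto simp: eventually_sequentially intro: less_imp_le)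
  have "\<exists>c\<ge>- real n. c \<le> real m \<and> \<phi> c = 0"
    using m n continuous_on_subset[OF cont] by (intro IVT2') auto
  then obtain c where "\<phi> c = 0" by blast
  with that[of c] show thesis by (simp add: wmean_def \<phi>_def)
qed

end

section \<open>From the embedding estimate to the Poincare inequality and back\<close>

context constant_kernel
begin

lemma embedding_bound_imp_poincare:
  assumes eb: embedding_bound and p: "1 \<le> p" and r: "r > 0"
  shows "\<exists>a>0. \<forall>f\<in>D \<inter> Linf M.
    (LINT x|M. \<bar>f x - wmean M w f\<bar> powr p * w x) powr (1/p) \<le> a * N f + r * osc M f"
proof -
  \<comment> \<open>Half of \<open>r powr p\<close>, because \<open>deviation_le_rho\<close> loses a
    factor 2.\<close>
  define \<epsilon> where "\<epsilon> = r powr p / 2"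
  have "\<epsilon> > 0" using r by (simp add: \<epsilon>_def)
  with eb obtain \<delta> where \<delta>: "\<delta> > 0" "\<And>f. f \<in> D \<Longrightarrow> N f < \<delta> \<Longrightarrow> near \<epsilon> f"
    unfolding embedding_bound_def by blast
  \<comment> \<open>The quotient is what the case of large seminorm requires; the summand 1 keeps
    \<open>a\<close> positive even if \<open>W = 0\<close>.\<close>
  define a where "a = W powr (1/p) / \<delta> + 1"
  have a: "a > 0" using \<delta>(1) by (auto simp: a_def intro: add_nonneg_pos)
  have "(LINT x|M. \<bar>f x - wmean M w f\<bar> powr p * w x) powr (1/p) \<le> a * N f + r * osc M f"
    (is "?I f powr _ \<le> _") if f: "f \<in> D" "f \<in> Linf M" for f
  proof -
    obtain b where b: "AE x in M. b \<le> f x \<and> f x \<le> b + osc M f" and osc: "0 \<le> osc M f"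
      using osc_bounds[OF f(2)] .
    define d where "d = osc M f"
    have fm [measurable]: "f \<in> borel_measurable M" using dom_L0[OF f(1)] by (simp add: L0_def)
    have rhs: "0 \<le> a * N f + r * d" using a r osc N_nonneg[OF f(1)] by (simp add: d_def)
    \<comment> \<open>Normalising by \<open>d\<close> requires \<open>d > 0\<close>. For
      \<open>d = 0\<close> the function equals its mean almost everywhere, and on a null space all
      integrals vanish.\<close>
    consider (null) "emeasure M (space M) = 0" | (const) "emeasure M (space M) \<noteq> 0" "d = 0"
      | (nonconst) "emeasure M (space M) \<noteq> 0" "d > 0"
      using osc unfolding d_def by linarith
    then show ?thesis
    proof cases
      case null
      have "?I f = 0" by (rule integral_eq_zero_AE[OF AE_null_space[OF null]])
      then show ?thesis using rhs by (simp add: d_def)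
    next
      case const
      have W: "W > 0" using W_pos const by simp
      have fb: "AE x in M. f x = b" using b const by (auto simp: d_def)
      have "(LINT x|M. f x * w x) = (LINT x|M. b * w x)"
        by (rule integral_cong_AE) (use fb in \<open>auto elim!: AE_mp\<close>)
      then have "wmean M w f = b" using W by (simp add: wmean_def)
      then have "?I f = 0" using fb by (intro integral_eq_zero_AE) (auto elim!: AE_mp)
      then show ?thesis using rhs by (simp add: d_def)
    next
      case nonconst
      have W: "W > 0" using W_pos nonconst by simp
      define g where "g x = 1/d * f x" for x
      have gm [measurable]: "g \<in> borel_measurable M" by (simp add: g_def[abs_def])
      have gD: "g \<in> D" unfolding g_def[abs_def] using nonconst by (intro dom_scale f) auto
      have Ng: "N g \<le> 1/d * N f" unfolding g_def[abs_def] using nonconst by (intro N_scale f) auto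
      have gb: "AE x in M. b/d \<le> g x \<and> g x \<le> b/d + 1"
        using b by eventually_elim (use nonconst in \<open>auto simp: g_def field_simps simp flip: d_def\<close>)
      have mean: "wmean M w f = d * wmean M w g"
        using nonconst by (simp add: wmean_def g_def)
      have "?I f = (LINT x|M. d powr p * (\<bar>g x - wmean M w g\<bar> powr p * w x))"
      proof (rule Bochner_Integration.integral_cong[OF refl])
        fix x
        have "f x - wmean M w f = d * (g x - wmean M w g)"
          using nonconst unfolding mean by (simp add: g_def right_diff_distrib)
        then have "\<bar>f x - wmean M w f\<bar> powr p = d powr p * \<bar>g x - wmean M w g\<bar> powr p"
          using nonconst by (simp add: abs_mult powr_mult)
        then show "\<bar>f x - wmean M w f\<bar> powr p * w x = d powr p * (\<bar>g x - wmean M w g\<bar> powr p * w x)"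
          by simp
      qed
      then have If: "?I f = d powr p * ?I g" by simp
      have Ig: "?I g \<ge> 0" using w_nonneg by (intro integral_nonneg_AE AE_I2) auto
      have eq: "?I f powr (1/p) = d * ?I g powr (1/p)"
        using nonconst p Ig unfolding If by (simp add: powr_mult powr_powr)
      show ?thesis
      \<comment> \<open>Below the threshold the normalised \<open>g\<close> has
        \<open>N g < \<delta>\<close> and is close to a constant; otherwise the bound by the total
        mass is absorbed into \<open>a * N f\<close>.\<close>
      proof (cases "N f < \<delta> * d")
        case True
        then have "1/d * N f < \<delta>" using nonconst by (simp add: field_simps)
        with Ng have "N g < \<delta>" by simp
        from \<delta>(2)[OF gD this] obtain c where c: "rho (\<lambda>x. g x - c) < \<epsilon>" by (auto simp: near_def)
        have "?I g \<le> r powr p"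
          using deviation_le_rho[OF gm gb W p, of c] c by (simp add: \<epsilon>_def)
        then have "?I g powr (1/p) \<le> (r powr p) powr (1/p)" using Ig p by (intro powr_mono2) auto
        then have "?I g powr (1/p) \<le> r" using r p by (simp add: powr_powr)
        then have "?I f powr (1/p) \<le> d * r" unfolding eq using nonconst by (intro mult_left_mono) auto
        moreover have "0 \<le> a * N f" using a N_nonneg[OF f(1)] by simp
        ultimately show ?thesis by (simp add: d_def mult.commute)
      next
        case False
        have "?I g powr (1/p) \<le> W powr (1/p)"
          using deviation_le_mass[OF gm gb W p] Ig p by (intro powr_mono2) auto
        then have "?I f powr (1/p) \<le> d * W powr (1/p)" unfolding eq using nonconst by (intro mult_left_mono) auto
        also have "\<dots> \<le> (N f / \<delta>) * W powr (1/p)"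
          using False \<delta>(1) by (intro mult_right_mono) (auto simp: field_simps)
        also have "\<dots> \<le> a * N f"
          using N_nonneg[OF f(1)] by (simp add: a_def algebra_simps)
        also have "\<dots> \<le> a * N f + r * osc M f" using r osc by simp
        finally show ?thesis .
      qed
    qed
  qed
  with a show ?thesis by blast
qed

text \<open>Constants found separately for each \<open>r\<close> need not decrease in
  \<open>r\<close>. The infimum of all admissible constants does, since \<open>osc\<close> is
  nonnegative and the admissible sets therefore grow with \<open>r\<close>.\<close>

lemma embedding_bound_imp_cond_iii:
  assumes eb: embedding_bound and p: "1 \<le> p"
  shows "cond_iii M E w p"
proof -
  define L where "L f = (LINT x|M. \<bar>f x - wmean M w f\<bar> powr p * w x) powr (1/p)" for f
  define A where "A r = {a. a > 0 \<and> (\<forall>f\<in>D \<inter> Linf M. L f \<le> a * N f + r * osc M f)}" for r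
  \<comment> \<open>Adding 1 gives positivity and leaves an admissible constant below
    \<open>\<alpha> r\<close>, even if the infimum is not attained.\<close>
  define \<alpha> where "\<alpha> r = 1 + Inf (A r)" for r
  have ne: "A r \<noteq> {}" if "r > 0" for r
    using embedding_bound_imp_poincare[OF eb p that] by (auto simp: A_def L_def)
  have bdd: "bdd_below (A r)" for r by (rule bdd_belowI[of _ 0]) (auto simp: A_def)
  have nonneg: "Inf (A r) \<ge> 0" if "r > 0" for r
    by (rule cInf_greatest[OF ne[OF that]]) (auto simp: A_def)
  show ?thesis
    unfolding cond_iii_def
  proof (intro exI[of _ \<alpha>] conjI allI impI ballI)
    fix r :: real assume "r > 0"
    then show "\<alpha> r > 0" using nonneg[of r] by (simp add: \<alpha>_def)
  next
    fix r s :: real assume rs: "0 < r \<and> r \<le> s"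
    have "A r \<subseteq> A s"
    proof
      fix a assume a: "a \<in> A r"
      have "L f \<le> a * N f + s * osc M f" if f: "f \<in> D \<inter> Linf M" for f
      proof -
        have "0 \<le> osc M f" using osc_bounds[of f M] f by auto
        then have "r * osc M f \<le> s * osc M f" using rs by (intro mult_right_mono) auto
        moreover have "L f \<le> a * N f + r * osc M f" using a f by (simp add: A_def)
        ultimately show ?thesis by simp
      qed
      with a show "a \<in> A s" by (simp add: A_def)
    qed
    then show "\<alpha> s \<le> \<alpha> r"
      using cInf_superset_mono[OF ne bdd, of r s] rs by (simp add: \<alpha>_def)
  next
    fix r f assume r: "(r::real) > 0" and f: "f \<in> D \<inter> Linf M"
    have "Inf (A r) < \<alpha> r" by (simp add: \<alpha>_def)
    from cInf_lessD[OF ne[OF r] this] obtain a where a: "a \<in> A r" "a < \<alpha> r" by blast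
    have "L f \<le> a * N f + r * osc M f" using a f by (simp add: A_def)
    also have "\<dots> \<le> \<alpha> r * N f + r * osc M f"
      using a f N_nonneg by (intro add_right_mono mult_right_mono) auto
    finally show "(LINT x|M. \<bar>f x - wmean M w f\<bar> powr p * w x) powr (1/p) \<le> \<alpha> r * N f + r * osc M f"
      by (simp add: L_def)
  qed
qed

lemma cond_iii_imp_embedding_bound:
  assumes c3: "cond_iii M E w p" and p: "1 \<le> p"
  shows embedding_bound
  unfolding embedding_bound_def
proof (intro allI impI)
  fix \<epsilon> :: real assume \<epsilon>: "\<epsilon> > 0"
  show "\<exists>\<delta>>0. \<forall>f\<in>D. N f < \<delta> \<longrightarrow> near \<epsilon> f"
  proof (cases "emeasure M (space M) = 0")
    case True
    have "rho (\<lambda>x. f x - 0) = 0" for f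
      unfolding rho_def by (rule integral_eq_zero_AE[OF AE_null_space[OF True]])
    then have "near \<epsilon> f" for f unfolding near_def using \<epsilon> by metis
    then show ?thesis by (intro exI[of _ 1]) auto
  next
    case False
    have W: "W > 0" using W_pos[OF False] .
    from c3 obtain \<alpha> :: "real \<Rightarrow> real" where \<alpha>: "\<And>r. r > 0 \<Longrightarrow> \<alpha> r > 0"
      and bound: "\<And>r f. r > 0 \<Longrightarrow> f \<in> D \<inter> Linf M \<Longrightarrow>
        (LINT x|M. \<bar>f x - wmean M w f\<bar> powr p * w x) powr (1/p) \<le> \<alpha> r * N f + r * osc M f"
      unfolding cond_iii_def by blast
    \<comment> \<open>The constants are fixed backwards: \<open>\<eta> * W = \<epsilon>/2\<close>
      and \<open>\<eta> powr (1 - p) * s powr p = \<epsilon>/4\<close>; (iii) is used with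
      \<open>r = s/4\<close>, so that \<open>osc \<le> 2\<close> and \<open>N g < \<delta>\<close>
      contribute at most \<open>s/2\<close> each.\<close>
    define \<eta> where "\<eta> = \<epsilon> / (2 * W)"
    define s where "s = (\<eta> powr (p - 1) * \<epsilon> / 4) powr (1/p)"
    have \<eta>: "\<eta> > 0" using \<epsilon> W by (simp add: \<eta>_def)
    have s: "s > 0" using \<epsilon> \<eta> by (simp add: s_def)
    have sp: "s powr p = \<eta> powr (p - 1) * \<epsilon> / 4" using \<epsilon> \<eta> p by (simp add: s_def powr_powr)
    define \<delta> where "\<delta> = s / (2 * \<alpha> (s/4))"
    have \<alpha>s: "\<alpha> (s/4) > 0" using \<alpha> s by simp
    have \<delta>: "\<delta> > 0" using s \<alpha>s by (simp add: \<delta>_def)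
    have "near \<epsilon> f" if f: "f \<in> D" "N f < \<delta>" for f
    proof -
      have fm [measurable]: "f \<in> borel_measurable M" using dom_L0[OF f(1)] by (simp add: L0_def)
      obtain c where c: "wmean M w (\<lambda>x. unit_clamp (f x - c)) = 0"
        using exists_clamped_mean_zero[OF fm W] .
      define g where "g x = unit_clamp (f x - c)" for x
      have gm [measurable]: "g \<in> borel_measurable M" by (simp add: g_def[abs_def])
      have gD: "g \<in> D" unfolding g_def[abs_def]
        by (rule dom_contraction[OF dom_shift[OF f(1)] unit_clamp_lipschitz unit_clamp_zero])
      have "N g \<le> N (\<lambda>x. f x - c)" unfolding g_def[abs_def]
        by (rule N_contraction[OF dom_shift[OF f(1)] unit_clamp_lipschitz unit_clamp_zero])
      then have Ng: "N g < \<delta>" using N_shift_le[OF f(1), of c] f(2) by simp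
      have ag: "\<bar>g x\<bar> = min \<bar>f x - c\<bar> 1" for x by (simp add: g_def abs_unit_clamp)
      have g1: "AE x in M. \<bar>g x\<bar> \<le> 1" by (simp add: ag)
      have gL: "g \<in> Linf M" using g1 gm unfolding Linf_def by blast
      have wm: "wmean M w g = 0" using c by (simp add: g_def[abs_def])
      define I where "I = (LINT x|M. \<bar>g x\<bar> powr p * w x)"
      have I: "I \<ge> 0" unfolding I_def using w_nonneg by (intro integral_nonneg_AE AE_I2) auto
      have "I powr (1/p) \<le> \<alpha> (s/4) * N g + s/4 * osc M g"
        using bound[of "s/4" g] s gD gL by (simp add: wm I_def)
      also have "\<dots> \<le> \<alpha> (s/4) * \<delta> + s/4 * 2"
        using \<alpha>s s Ng osc_le_2[OF gm g1] by (intro add_mono mult_left_mono) auto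
      also have "\<dots> = s" using \<alpha>s by (simp add: \<delta>_def)
      finally have "(I powr (1/p)) powr p \<le> s powr p" using p by (intro powr_mono2) auto
      then have Is: "I \<le> \<eta> powr (p - 1) * \<epsilon> / 4" using I p sp by (simp add: powr_powr)
      \<comment> \<open>Recovers the first power from the \<open>p\<close>-th: for
        \<open>t > \<eta>\<close>, write \<open>t = t powr (1 - p) * t powr p\<close> and use
        \<open>1 - p \<le> 0\<close> in the first factor.\<close>
      have pt: "t \<le> \<eta> + \<eta> powr (1 - p) * t powr p" if t: "0 \<le> t" for t
      proof (cases "t \<le> \<eta>")
        case True
        then show ?thesis by (simp add: add_increasing2)
      next
        case False
        then have "t powr (1 - p) \<le> \<eta> powr (1 - p)" using \<eta> p by (intro powr_mono2') auto
        then have "t powr (1 - p) * t powr p \<le> \<eta> powr (1 - p) * t powr p" by (intro mult_right_mono) auto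
        moreover have "t powr (1 - p) * t powr p = t" using False \<eta> by (simp flip: powr_add)
        ultimately show ?thesis using \<eta> by simp
      qed
      have ip: "integrable M (\<lambda>x. \<bar>g x\<bar> powr p * w x)"
      proof (rule weighted_integrable[where C = 1])
        have "\<bar>g x\<bar> powr p \<le> \<bar>g x\<bar>" for x by (rule powr_le_self[OF _ _ p]) (auto simp: ag)
        then have "\<bar>g x\<bar> powr p \<le> 1" for x by (rule order_trans) (simp add: ag)
        then show "AE x in M. \<bar>\<bar>g x\<bar> powr p\<bar> \<le> 1" by simp
      qed simp
      have "rho (\<lambda>x. f x - c) = (LINT x|M. \<bar>g x\<bar> * w x)" by (simp add: rho_def ag)
      also have "\<dots> \<le> (LINT x|M. (\<eta> + \<eta> powr (1 - p) * \<bar>g x\<bar> powr p) * w x)"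
      proof (rule weighted_integral_mono)
        show "integrable M (\<lambda>x. \<bar>g x\<bar> * w x)" by (rule weighted_integrable[where C = 1]) (auto simp: ag)
        show "integrable M (\<lambda>x. (\<eta> + \<eta> powr (1 - p) * \<bar>g x\<bar> powr p) * w x)"
          using ip w_integrable by (simp add: distrib_right mult.assoc)
      qed (use pt in auto)
      also have "\<dots> = \<eta> * W + \<eta> powr (1 - p) * I"
        using ip w_integrable by (simp add: distrib_right mult.assoc I_def)
      also have "\<dots> \<le> \<epsilon>/2 + \<eta> powr (1 - p) * (\<eta> powr (p - 1) * \<epsilon> / 4)"
        using Is W by (intro add_mono mult_left_mono) (auto simp: \<eta>_def)
      also have "\<eta> powr (1 - p) * (\<eta> powr (p - 1) * \<epsilon> / 4) = \<epsilon> / 4"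
        using \<eta> by (simp add: mult.assoc[symmetric] flip: powr_add)
      also have "\<epsilon>/2 + \<epsilon>/4 < \<epsilon>" using \<epsilon> by simp
      finally show "near \<epsilon> f" by (auto simp: near_def)
    qed
    with \<delta> show ?thesis by blast
  qed
qed

end

section \<open>Passage from one weight and exponent to all\<close>

theorem theorem4p9:
  fixes M :: "'a measure" and E :: "('a \<Rightarrow> real) \<Rightarrow> ennreal"
  assumes "sigma_finite_measure M"
    and "nonlinear_dirichlet_form M E"
    and "{f \<in> dom_M M E. Le_norm M E f = 0} = {f \<in> L0 M. \<exists>c::real. AE x in M. f x = c}"
  shows "(Me_complete M E \<longleftrightarrow>
            continuous_map (Me_quot_topology M E) (L0_quot_topology M) (\<lambda>C. C))
       \<and> (continuous_map (Me_quot_topology M E) (L0_quot_topology M) (\<lambda>C. C) \<longleftrightarrow>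
            (\<exists>w p. weight M w \<and> 1 \<le> p \<and> cond_iii M E w p))
       \<and> (continuous_map (Me_quot_topology M E) (L0_quot_topology M) (\<lambda>C. C) \<longleftrightarrow>
            (\<forall>w p. weight M w \<and> 1 \<le> p \<longrightarrow> cond_iii M E w p))"
proof -
  let ?cont = "continuous_map (Me_quot_topology M E) (L0_quot_topology M) (\<lambda>C. C)"
  have ck: "constant_kernel M w E" if "weight M w" for w
    by unfold_locales (use that assms in auto)
  have complete: "Me_complete M E \<longleftrightarrow> ?cont" if "weight M w" for w
  proof -
    interpret constant_kernel M w E by (rule ck[OF that])
    show ?thesis
      using continuous_iff_embedding_bound embedding_bound_imp_complete complete_imp_embedding_bound
      by blast
  qed
  \<comment> \<open>Completeness and continuity mention neither \<open>w\<close> nor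
    \<open>p\<close>, so passing through them connects any two choices in (iii).\<close>
  have poincare: "cond_iii M E w p \<longleftrightarrow> ?cont" if "weight M w" "1 \<le> p" for w p
  proof -
    interpret constant_kernel M w E by (rule ck[OF that(1)])
    show ?thesis
      using continuous_iff_embedding_bound embedding_bound_imp_cond_iii[OF _ that(2)]
        cond_iii_imp_embedding_bound[OF _ that(2)] by blast
  qed
  \<comment> \<open>Sigma-finiteness enters here: it supplies a weight, on which the metric
    description of the topology and the passage from all weights to one rest.\<close>
  have "\<exists>w. weight M w"
    by (rule sigma_finite_measure.obtain_positive_integrable_function[OF assms(1)])
       (auto simp: weight_def)
  then obtain w where w: "weight M w" ..
  show ?thesis
    using complete[OF w] poincare w order_refl[of "1::real"] by blast
qed

end
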